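(* Let $\mathscr{A}$ be an abelian category with enough projective objects, let $\mathscr{E}$ be a subcategory of $\mathscr{A}$, and let $\mathscr{T}$ be a resolving subcategory of $\mathscr{A}$ admitting an $\mathscr{E}$-coproper cogenerator $\mathscr{C}$. Then (1) $\mathscr{T}\text{-}\mathrm{FPD}\leq\mathscr{C}\text{-}\mathrm{FPD}$. (2) If $\mathscr{T}\subseteq{^{\bot}\mathscr{C}}$, then $\mathscr{T}\text{-}\operatorname{pd} M=\mathscr{C}\text{-}\operatorname{pd} M$ for any $M\in\mathscr{A}$ with $\mathscr{C}\text{-}\operatorname{pd} M<\infty$. (3) If $\mathscr{T}\subseteq{^{\bot}\mathscr{C}}$, then $\mathscr{T}\text{-}\mathrm{FPD}=\mathscr{C}\text{-}\mathrm{FPD}$.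
   Context: All subcategories are full, additive and closed under isomorphisms and direct summands. For a subcategory $\mathscr{X}$ of $\mathscr{A}$ and $M\in\mathscr{A}$, $\mathscr{X}\text{-}\operatorname{pd} M$ is the infimum of the integers $n\ge 0$ such that there is an exact sequence $0 \to X_n \to \cdots \to X_0 \to M\to 0$ in $\mathscr{A}$ with all $X_i\in\mathscr{X}$ ($\infty$ if no such $n$ exists), and $\mathscr{X}\text{-}\mathrm{FPD}:=\sup\{\mathscr{X}\text{-}\operatorname{pd} M\mid M\in\mathscr{A},\ \mathscr{X}\text{-}\operatorname{pd} M<\infty\}$. ${^\perp\mathscr{X}}:=\{A\in\mathscr{A}\mid\operatorname{Ext}^{\geq 1}_{\mathscr{A}}(A,X)=0 \text{ for any } X\in \mathscr{X}\}$. A subcategory is resolving if it contains all projective objects and is closed under extensions and kernels of epimorphisms. For subcategories $\mathscr{C}\subseteq\mathscr{T}$, $\mathscr{C}$ is an $\mathscr{E}$-coproper cogenerator for $\mathscr{T}$ if for any $T\in\mathscr{T}$ there is an exact sequence $0\to T\to C\to T'\to 0$ in $\mathscr{A}$ with $C\in\mathscr{C}$, $T'\in\mathscr{T}$, which remains exact under $\operatorname{Hom}_{\mathscr{A}}(-,E)$ for every $E\in\mathscr{E}$. *)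

theory Defs
  imports "HOL-Algebra.Exact_Sequence" "HOL-Library.Extended_Nat"
begin

section \<open>Abelian categories\<close>

text \<open>
  The library has no category theory, so the standard notions are set up here. \<open>cmp C g f\<close>
  is \<open>g\<close> after \<open>f\<close>; \<open>hplus\<close> adds parallel arrows, and \<open>hzero C X Y\<close> is the zero arrow from
  \<open>X\<close> to \<open>Y\<close>.
\<close>

record ('o, 'm) cat =
  Ob :: "'o set"
  Ar :: "'m set"
  src :: "'m \<Rightarrow> 'o"
  trg :: "'m \<Rightarrow> 'o"
  idt :: "'o \<Rightarrow> 'm"
  cmp :: "'m \<Rightarrow> 'm \<Rightarrow> 'm"  (infixr \<open>\<cdot>\<index>\<close> 75)
  hplus :: "'m \<Rightarrow> 'm \<Rightarrow> 'm"
  hzero :: "'o \<Rightarrow> 'o \<Rightarrow> 'm"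

definition Hom :: "('o, 'm) cat \<Rightarrow> 'o \<Rightarrow> 'o \<Rightarrow> 'm set" where
  "Hom C X Y = {f \<in> Ar C. src C f = X \<and> trg C f = Y}"

definition Hom_group :: "('o, 'm) cat \<Rightarrow> 'o \<Rightarrow> 'o \<Rightarrow> 'm monoid" where
  "Hom_group C X Y = \<lparr>carrier = Hom C X Y, monoid.mult = hplus C, one = hzero C X Y\<rparr>"

locale category =
  fixes C :: "('o, 'm) cat" (structure)
  assumes src_in_Ob: "f \<in> Ar C \<Longrightarrow> src C f \<in> Ob C"
    and trg_in_Ob: "f \<in> Ar C \<Longrightarrow> trg C f \<in> Ob C"
    and idt_in_Hom: "X \<in> Ob C \<Longrightarrow> idt C X \<in> Hom C X X"
    and cmp_in_Hom: "\<lbrakk>f \<in> Hom C X Y; g \<in> Hom C Y Z\<rbrakk> \<Longrightarrow> g \<cdot> f \<in> Hom C X Z"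
    and cmp_idt_right: "f \<in> Hom C X Y \<Longrightarrow> f \<cdot> idt C X = f"
    and cmp_idt_left: "f \<in> Hom C X Y \<Longrightarrow> idt C Y \<cdot> f = f"
    and cmp_assoc:
      "\<lbrakk>f \<in> Hom C W X; g \<in> Hom C X Y; h \<in> Hom C Y Z\<rbrakk> \<Longrightarrow> (h \<cdot> g) \<cdot> f = h \<cdot> (g \<cdot> f)"

locale preadditive_category = category +
  assumes comm_group_Hom: "\<lbrakk>X \<in> Ob C; Y \<in> Ob C\<rbrakk> \<Longrightarrow> comm_group (Hom_group C X Y)"
    and cmp_hplus_right:
      "\<lbrakk>f \<in> Hom C X Y; f' \<in> Hom C X Y; g \<in> Hom C Y Z\<rbrakk>
        \<Longrightarrow> g \<cdot> hplus C f f' = hplus C (g \<cdot> f) (g \<cdot> f')"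
    and cmp_hplus_left:
      "\<lbrakk>f \<in> Hom C X Y; g \<in> Hom C Y Z; g' \<in> Hom C Y Z\<rbrakk>
        \<Longrightarrow> hplus C g g' \<cdot> f = hplus C (g \<cdot> f) (g' \<cdot> f)"

definition zero_object :: "('o, 'm) cat \<Rightarrow> 'o \<Rightarrow> bool" where
  "zero_object C Z \<longleftrightarrow> Z \<in> Ob C \<and>
     (\<forall>X\<in>Ob C. (\<exists>!f. f \<in> Hom C X Z) \<and> (\<exists>!f. f \<in> Hom C Z X))"

definition is_biproduct :: "('o, 'm) cat \<Rightarrow> 'o \<Rightarrow> 'o \<Rightarrow> 'o \<Rightarrow> bool" where
  "is_biproduct C X Y S \<longleftrightarrow>
     (\<exists>i\<in>Hom C X S. \<exists>j\<in>Hom C Y S. \<exists>p\<in>Hom C S X. \<exists>q\<in>Hom C S Y.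
        p \<cdot>\<^bsub>C\<^esub> i = idt C X \<and> q \<cdot>\<^bsub>C\<^esub> j = idt C Y \<and>
        q \<cdot>\<^bsub>C\<^esub> i = hzero C X Y \<and> p \<cdot>\<^bsub>C\<^esub> j = hzero C Y X \<and>
        hplus C (i \<cdot>\<^bsub>C\<^esub> p) (j \<cdot>\<^bsub>C\<^esub> q) = idt C S)"

locale additive_category = preadditive_category +
  assumes ex_zero_object: "\<exists>Z. zero_object C Z"
    and ex_biproduct: "\<lbrakk>X \<in> Ob C; Y \<in> Ob C\<rbrakk> \<Longrightarrow> \<exists>S\<in>Ob C. is_biproduct C X Y S"

definition is_mono :: "('o, 'm) cat \<Rightarrow> 'm \<Rightarrow> bool" where
  "is_mono C f \<longleftrightarrow> f \<in> Ar C \<and>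
     (\<forall>W. \<forall>g\<in>Hom C W (src C f). \<forall>h\<in>Hom C W (src C f). f \<cdot>\<^bsub>C\<^esub> g = f \<cdot>\<^bsub>C\<^esub> h \<longrightarrow> g = h)"

definition is_epi :: "('o, 'm) cat \<Rightarrow> 'm \<Rightarrow> bool" where
  "is_epi C f \<longleftrightarrow> f \<in> Ar C \<and>
     (\<forall>W. \<forall>g\<in>Hom C (trg C f) W. \<forall>h\<in>Hom C (trg C f) W. g \<cdot>\<^bsub>C\<^esub> f = h \<cdot>\<^bsub>C\<^esub> f \<longrightarrow> g = h)"

definition is_iso :: "('o, 'm) cat \<Rightarrow> 'm \<Rightarrow> bool" where
  "is_iso C f \<longleftrightarrow> f \<in> Ar C \<and>
     (\<exists>g\<in>Hom C (trg C f) (src C f). g \<cdot>\<^bsub>C\<^esub> f = idt C (src C f) \<and> f \<cdot>\<^bsub>C\<^esub> g = idt C (trg C f))"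

definition is_kernel :: "('o, 'm) cat \<Rightarrow> 'm \<Rightarrow> 'm \<Rightarrow> bool" where
  "is_kernel C f k \<longleftrightarrow> f \<in> Ar C \<and> k \<in> Ar C \<and> trg C k = src C f \<and>
     f \<cdot>\<^bsub>C\<^esub> k = hzero C (src C k) (trg C f) \<and>
     (\<forall>W. \<forall>g\<in>Hom C W (src C f). f \<cdot>\<^bsub>C\<^esub> g = hzero C W (trg C f) \<longrightarrow>
        (\<exists>!h. h \<in> Hom C W (src C k) \<and> k \<cdot>\<^bsub>C\<^esub> h = g))"

definition is_cokernel :: "('o, 'm) cat \<Rightarrow> 'm \<Rightarrow> 'm \<Rightarrow> bool" where
  "is_cokernel C f c \<longleftrightarrow> f \<in> Ar C \<and> c \<in> Ar C \<and> src C c = trg C f \<and>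
     c \<cdot>\<^bsub>C\<^esub> f = hzero C (src C f) (trg C c) \<and>
     (\<forall>W. \<forall>g\<in>Hom C (trg C f) W. g \<cdot>\<^bsub>C\<^esub> f = hzero C (src C f) W \<longrightarrow>
        (\<exists>!h. h \<in> Hom C (trg C c) W \<and> h \<cdot>\<^bsub>C\<^esub> c = g))"

locale abelian_category = additive_category +
  assumes ex_kernel: "f \<in> Ar C \<Longrightarrow> \<exists>k. is_kernel C f k"
    and ex_cokernel: "f \<in> Ar C \<Longrightarrow> \<exists>c. is_cokernel C f c"
    and mono_is_kernel: "is_mono C f \<Longrightarrow> \<exists>g. is_kernel C g f"
    and epi_is_cokernel: "is_epi C f \<Longrightarrow> \<exists>g. is_cokernel C g f"

definition projective :: "('o, 'm) cat \<Rightarrow> 'o \<Rightarrow> bool" where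
  "projective C P \<longleftrightarrow> P \<in> Ob C \<and>
     (\<forall>e. is_epi C e \<longrightarrow>
        (\<forall>f\<in>Hom C P (trg C e). \<exists>g\<in>Hom C P (src C e). e \<cdot>\<^bsub>C\<^esub> g = f))"

definition enough_projectives :: "('o, 'm) cat \<Rightarrow> bool" where
  "enough_projectives C \<longleftrightarrow>
     (\<forall>M\<in>Ob C. \<exists>e. is_epi C e \<and> trg C e = M \<and> projective C (src C e))"

section \<open>Exactness\<close>

definition is_image :: "('o, 'm) cat \<Rightarrow> 'm \<Rightarrow> 'm \<Rightarrow> bool" where
  "is_image C f m \<longleftrightarrow> (\<exists>c. is_cokernel C f c \<and> is_kernel C c m)"

text \<open>Exactness of \<open>X \<rightarrow> Y \<rightarrow> Z\<close> (first \<open>f\<close>, then \<open>g\<close>) at \<open>Y\<close>: image and kernel are the same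
  subobject.\<close>

definition exact_at :: "('o, 'm) cat \<Rightarrow> 'm \<Rightarrow> 'm \<Rightarrow> bool" where
  "exact_at C f g \<longleftrightarrow> trg C f = src C g \<and> (\<exists>m. is_image C f m \<and> is_kernel C g m)"

definition short_exact :: "('o, 'm) cat \<Rightarrow> 'm \<Rightarrow> 'm \<Rightarrow> bool" where
  "short_exact C f g \<longleftrightarrow>
     (\<exists>Z. zero_object C Z \<and> exact_at C (hzero C Z (src C f)) f \<and> exact_at C f g \<and>
          exact_at C g (hzero C (trg C g) Z))"

text \<open>Exactness of \<open>0 \<rightarrow> Hom(Z,E) \<rightarrow> Hom(Y,E) \<rightarrow> Hom(X,E) \<rightarrow> 0\<close> for \<open>f : X \<rightarrow> Y\<close> and \<open>g : Y \<rightarrow> Z\<close>.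
  The library's \<^const>\<open>exact_seq\<close> lists groups and maps from right to left.\<close>

definition Hom_into_exact :: "('o, 'm) cat \<Rightarrow> 'o \<Rightarrow> 'm \<Rightarrow> 'm \<Rightarrow> bool" where
  "Hom_into_exact C E f g \<longleftrightarrow>
     (let X = src C f; Y = trg C f; Z = trg C g; z = hzero C X E in
      exact_seq
        ([singleton_group z, Hom_group C X E, Hom_group C Y E, Hom_group C Z E, singleton_group z],
         [\<lambda>_. z, \<lambda>h. h \<cdot>\<^bsub>C\<^esub> f, \<lambda>h. h \<cdot>\<^bsub>C\<^esub> g, \<lambda>_. hzero C Z E]))"

section \<open>Ext\<close>

text \<open>A projective resolution is given by its arrows: \<open>d 0\<close> is the augmentation \<open>P\<^sub>0 \<rightarrow> M\<close> and
  \<open>d (Suc n)\<close> is the differential from \<open>P\<close> in degree \<open>n + 1\<close> to \<open>P\<close> in degree \<open>n\<close>, so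
  \<open>P\<close> in degree \<open>n\<close> is \<open>src C (d n)\<close>.\<close>

definition projective_resolution :: "('o, 'm) cat \<Rightarrow> 'o \<Rightarrow> (nat \<Rightarrow> 'm) \<Rightarrow> bool" where
  "projective_resolution C M d \<longleftrightarrow>
     (\<forall>n. projective C (src C (d n))) \<and> trg C (d 0) = M \<and>
     (\<exists>Z. zero_object C Z \<and> exact_at C (d 0) (hzero C M Z)) \<and>
     (\<forall>n. exact_at C (d (Suc n)) (d n))"

text \<open>Cocycles and coboundaries of the complex obtained by applying \<open>Hom(-, X)\<close> to the deleted
  resolution; hence \<open>d 0\<close> does not contribute coboundaries.\<close>

definition Ext_cocycles :: "('o, 'm) cat \<Rightarrow> (nat \<Rightarrow> 'm) \<Rightarrow> 'o \<Rightarrow> nat \<Rightarrow> 'm set" where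
  "Ext_cocycles C d X n =
     {f \<in> Hom C (src C (d n)) X. f \<cdot>\<^bsub>C\<^esub> d (Suc n) = hzero C (src C (d (Suc n))) X}"

definition Ext_coboundaries :: "('o, 'm) cat \<Rightarrow> (nat \<Rightarrow> 'm) \<Rightarrow> 'o \<Rightarrow> nat \<Rightarrow> 'm set" where
  "Ext_coboundaries C d X n =
     (case n of
        0 \<Rightarrow> {hzero C (src C (d 0)) X}
      | Suc k \<Rightarrow> (\<lambda>g. g \<cdot>\<^bsub>C\<^esub> d (Suc k)) ` Hom C (src C (d k)) X)"

text \<open>As usual, Ext is computed from one chosen projective resolution; up to isomorphism it does
  not depend on the choice.\<close>

definition Ext :: "('o, 'm) cat \<Rightarrow> nat \<Rightarrow> 'o \<Rightarrow> 'o \<Rightarrow> 'm set monoid" where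
  "Ext C n A X =
     (let d = (SOME d. projective_resolution C A d) in
      (Hom_group C (src C (d n)) X)\<lparr>carrier := Ext_cocycles C d X n\<rparr> Mod Ext_coboundaries C d X n)"

section \<open>Subcategories and relative dimensions\<close>

text \<open>A full subcategory is given by its set of objects. Additivity is the presence of a zero
  object and closure under finite direct sums.\<close>

definition subcategory :: "('o, 'm) cat \<Rightarrow> 'o set \<Rightarrow> bool" where
  "subcategory C \<X> \<longleftrightarrow> \<X> \<subseteq> Ob C \<and>
     (\<exists>Z\<in>\<X>. zero_object C Z) \<and>
     (\<forall>X\<in>\<X>. \<forall>Y\<in>\<X>. \<forall>S\<in>Ob C. is_biproduct C X Y S \<longrightarrow> S \<in> \<X>) \<and>
     (\<forall>f. is_iso C f \<and> src C f \<in> \<X> \<longrightarrow> trg C f \<in> \<X>) \<and>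
     (\<forall>X\<in>Ob C. \<forall>Y\<in>Ob C. \<forall>S\<in>\<X>. is_biproduct C X Y S \<longrightarrow> X \<in> \<X>)"

text \<open>\<open>d 0\<close> is the arrow \<open>X\<^sub>0 \<rightarrow> M\<close> and \<open>d (Suc i)\<close> is the arrow out of the term of degree \<open>i + 1\<close>.\<close>

definition has_resolution :: "('o, 'm) cat \<Rightarrow> 'o set \<Rightarrow> nat \<Rightarrow> 'o \<Rightarrow> bool" where
  "has_resolution C \<X> n M \<longleftrightarrow>
     (\<exists>Z d. zero_object C Z \<and> (\<forall>i\<le>n. src C (d i) \<in> \<X>) \<and> trg C (d 0) = M \<and>
        exact_at C (hzero C Z (src C (d n))) (d n) \<and>
        (\<forall>i<n. exact_at C (d (Suc i)) (d i)) \<and>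
        exact_at C (d 0) (hzero C M Z))"

definition pd :: "('o, 'm) cat \<Rightarrow> 'o set \<Rightarrow> 'o \<Rightarrow> enat" where
  "pd C \<X> M = Inf {enat n | n. has_resolution C \<X> n M}"

definition FPD :: "('o, 'm) cat \<Rightarrow> 'o set \<Rightarrow> enat" where
  "FPD C \<X> = Sup {pd C \<X> M | M. M \<in> Ob C \<and> pd C \<X> M < \<infinity>}"

definition left_perp :: "('o, 'm) cat \<Rightarrow> 'o set \<Rightarrow> 'o set" where
  "left_perp C \<X> = {A \<in> Ob C. \<forall>X\<in>\<X>. \<forall>n\<ge>1. trivial_group (Ext C n A X)}"

definition resolving :: "('o, 'm) cat \<Rightarrow> 'o set \<Rightarrow> bool" where
  "resolving C \<T> \<longleftrightarrow> subcategory C \<T> \<and>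
     (\<forall>P. projective C P \<longrightarrow> P \<in> \<T>) \<and>
     (\<forall>f g. short_exact C f g \<and> src C f \<in> \<T> \<and> trg C g \<in> \<T> \<longrightarrow> trg C f \<in> \<T>) \<and>
     (\<forall>f g. short_exact C f g \<and> trg C f \<in> \<T> \<and> trg C g \<in> \<T> \<longrightarrow> src C f \<in> \<T>)"

definition coproper_cogenerator :: "('o, 'm) cat \<Rightarrow> 'o set \<Rightarrow> 'o set \<Rightarrow> 'o set \<Rightarrow> bool" where
  "coproper_cogenerator C \<E> \<C> \<T> \<longleftrightarrow> subcategory C \<C> \<and> subcategory C \<T> \<and> \<C> \<subseteq> \<T> \<and>
     (\<forall>T\<in>\<T>. \<exists>f g. short_exact C f g \<and> src C f = T \<and> trg C f \<in> \<C> \<and> trg C g \<in> \<T> \<and>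
        (\<forall>E\<in>\<E>. Hom_into_exact C E f g))"

end

theory Submission
  imports Defs
begin

text \<open>
  If \<open>\<T>\<close>-pd \<open>M = n\<close>, then pushing a \<open>\<T>\<close>-resolution of \<open>M\<close> out along the cogenerator sequences gives
  a short exact sequence \<open>0 \<rightarrow> M \<rightarrow> Y \<rightarrow> T \<rightarrow> 0\<close> with \<open>\<C>\<close>-pd \<open>Y \<le> n\<close> and \<open>T \<in> \<T>\<close> (Auslander--Buchweitz). As
  \<open>\<T>\<close> is resolving, \<open>\<T>\<close>-pd \<open>M \<le> \<T>\<close>-pd \<open>Y \<le> \<C>\<close>-pd \<open>Y\<close>, which gives (1). For (2), truncate a finite
  \<open>\<C>\<close>-resolution of \<open>M\<close> in degree \<open>n = \<T>\<close>-pd \<open>M\<close>: by Schanuel's argument the \<open>n\<close>-th syzygy lies in \<open>\<T>\<close>,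
  and since \<open>Ext\<^sup>1(\<T>, \<C>) = 0\<close> the rest of the resolution splits from the left end on, so that
  syzygy lies in \<open>\<C>\<close>. Part (3) follows from (1) and (2).
\<close>

section \<open>Additive calculus of arrows\<close>

context category
begin

lemma Hom_iff: "f \<in> Hom C X Y \<longleftrightarrow> f \<in> Ar C \<and> src C f = X \<and> trg C f = Y \<and> X \<in> Ob C \<and> Y \<in> Ob C"
  using src_in_Ob trg_in_Ob by (auto simp: Hom_def)

lemma ArE:
  assumes "f \<in> Ar C"
  obtains X Y where "f \<in> Hom C X Y"
  using assms by (auto simp: Hom_def)

lemma cmp_arrow [simp]:
  assumes "f \<in> Ar C" "g \<in> Ar C" "src C g = trg C f"
  shows "g \<cdot> f \<in> Ar C" "src C (g \<cdot> f) = src C f" "trg C (g \<cdot> f) = trg C g"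
  using cmp_in_Hom[of f "src C f" "trg C f" g "trg C g"] assms by (auto simp: Hom_def)

lemma idt_arrow [simp]:
  assumes "X \<in> Ob C"
  shows "idt C X \<in> Ar C" "src C (idt C X) = X" "trg C (idt C X) = X"
  using idt_in_Hom[OF assms] by (auto simp: Hom_def)

lemma cmp_assoc_arrow [simp]:
  assumes "f \<in> Ar C" "g \<in> Ar C" "h \<in> Ar C" "src C g = trg C f" "src C h = trg C g"
  shows "(h \<cdot> g) \<cdot> f = h \<cdot> (g \<cdot> f)"
  using cmp_assoc[of f "src C f" "trg C f" g "trg C g" h "trg C h"] assms by (auto simp: Hom_def)

lemma cmp_idt_arrow [simp]:
  assumes "f \<in> Ar C"
  shows "X = src C f \<Longrightarrow> f \<cdot> idt C X = f" "Y = trg C f \<Longrightarrow> idt C Y \<cdot> f = f"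
  using cmp_idt_right[of f "src C f" "trg C f"] cmp_idt_left[of f "src C f" "trg C f"] assms
  by (auto simp: Hom_def)

lemma mono_cancel:
  assumes "is_mono C f" "f \<in> Hom C X Y" "g \<in> Hom C W X" "h \<in> Hom C W X" "f \<cdot> g = f \<cdot> h"
  shows "g = h"
  using assms unfolding is_mono_def Hom_def by auto

lemma epi_cancel:
  assumes "is_epi C f" "f \<in> Hom C X Y" "g \<in> Hom C Y W" "h \<in> Hom C Y W" "g \<cdot> f = h \<cdot> f"
  shows "g = h"
  using assms unfolding is_epi_def Hom_def by auto

lemma split_mono:
  assumes "f \<in> Hom C X Y" "g \<in> Hom C Y X" "g \<cdot> f = idt C X"
  shows "is_mono C f"
  unfolding is_mono_def
proof (intro conjI allI ballI impI)
  fix W u v assume u: "u \<in> Hom C W (src C f)" and v: "v \<in> Hom C W (src C f)" and eq: "f \<cdot> u = f \<cdot> v"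
  have "(g \<cdot> f) \<cdot> u = (g \<cdot> f) \<cdot> v" using assms(1,2) u v eq by (simp add: Hom_iff)
  then show "u = v" using assms u v by (simp add: Hom_iff)
qed (use assms in \<open>simp add: Hom_iff\<close>)

lemma mono_comp:
  assumes "is_mono C f" "is_mono C g" "f \<in> Hom C X Y" "g \<in> Hom C Y Z"
  shows "is_mono C (g \<cdot> f)"
  unfolding is_mono_def
proof (intro conjI allI ballI impI)
  fix W u v
  assume u: "u \<in> Hom C W (src C (g \<cdot> f))" and v: "v \<in> Hom C W (src C (g \<cdot> f))"
    and eq: "(g \<cdot> f) \<cdot> u = (g \<cdot> f) \<cdot> v"
  have uv: "u \<in> Hom C W X" "v \<in> Hom C W X" using u v assms(3,4) by (simp_all add: Hom_iff)
  have "g \<cdot> (f \<cdot> u) = g \<cdot> (f \<cdot> v)" using assms(3,4) uv eq by (simp add: Hom_iff)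
  from mono_cancel[OF assms(2,4) _ _ this] have "f \<cdot> u = f \<cdot> v"
    using uv assms(3) cmp_in_Hom by blast
  then show "u = v" using mono_cancel[OF assms(1,3) uv] by blast
qed (use assms in \<open>simp add: Hom_iff\<close>)

lemma mono_right_factor:
  assumes "is_mono C (g \<cdot> f)" "f \<in> Hom C X Y" "g \<in> Hom C Y Z"
  shows "is_mono C f"
  unfolding is_mono_def
proof (intro conjI allI ballI impI)
  fix W u v assume uv: "u \<in> Hom C W (src C f)" "v \<in> Hom C W (src C f)" and eq: "f \<cdot> u = f \<cdot> v"
  have "(g \<cdot> f) \<cdot> u = (g \<cdot> f) \<cdot> v" using assms(2,3) uv eq by (simp add: Hom_iff)
  then show "u = v" using mono_cancel[OF assms(1) cmp_in_Hom[OF assms(2,3)]] uv assms(2)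
    by (simp add: Hom_iff)
qed (use assms in \<open>simp add: Hom_iff\<close>)

end

context preadditive_category
begin

lemma hzero_arrow [simp]:
  assumes "X \<in> Ob C" "Y \<in> Ob C"
  shows "hzero C X Y \<in> Ar C" "src C (hzero C X Y) = X" "trg C (hzero C X Y) = Y"
proof -
  interpret G: comm_group "Hom_group C X Y" using comm_group_Hom assms by blast
  have "hzero C X Y \<in> Hom C X Y" using G.one_closed by (simp add: Hom_group_def)
  then show "hzero C X Y \<in> Ar C" "src C (hzero C X Y) = X" "trg C (hzero C X Y) = Y"
    by (auto simp: Hom_def)
qed

lemma hzero_in_Hom: "X \<in> Ob C \<Longrightarrow> Y \<in> Ob C \<Longrightarrow> hzero C X Y \<in> Hom C X Y"
  by (simp add: Hom_iff)

lemma hplus_in_Hom: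
  assumes "f \<in> Hom C X Y" "g \<in> Hom C X Y" shows "hplus C f g \<in> Hom C X Y"
proof -
  interpret G: comm_group "Hom_group C X Y" using comm_group_Hom assms by (auto simp: Hom_iff)
  show ?thesis using G.m_closed[of f g] assms by (simp add: Hom_group_def)
qed

lemma hplus_arrow [simp]:
  assumes "f \<in> Ar C" "g \<in> Ar C" "src C f = src C g" "trg C f = trg C g"
  shows "hplus C f g \<in> Ar C" "src C (hplus C f g) = src C g" "trg C (hplus C f g) = trg C g"
  using hplus_in_Hom[of f "src C g" "trg C g" g] assms by (auto simp: Hom_def)

lemma hplus_comm:
  assumes "f \<in> Hom C X Y" "g \<in> Hom C X Y" shows "hplus C f g = hplus C g f"
proof -
  interpret G: comm_group "Hom_group C X Y" using comm_group_Hom assms by (auto simp: Hom_iff)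
  show ?thesis using G.m_comm[of f g] assms by (simp add: Hom_group_def)
qed

lemma hplus_hzero [simp]:
  assumes "f \<in> Ar C" "X = src C f" "Y = trg C f"
  shows "hplus C f (hzero C X Y) = f" "hplus C (hzero C X Y) f = f"
proof -
  interpret G: comm_group "Hom_group C X Y" using comm_group_Hom assms src_in_Ob trg_in_Ob by auto
  show "hplus C f (hzero C X Y) = f" "hplus C (hzero C X Y) f = f"
    using G.r_one[of f] G.l_one[of f] assms by (simp_all add: Hom_group_def Hom_def)
qed

lemma hplus_eq_self:
  assumes "f \<in> Hom C X Y" "g \<in> Hom C X Y" "hplus C f g = g"
  shows "f = hzero C X Y"
proof -
  interpret G: comm_group "Hom_group C X Y" using comm_group_Hom assms by (auto simp: Hom_iff)
  show ?thesis using G.r_cancel_one[of g f] assms by (simp add: Hom_group_def)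
qed

lemma cmp_hplus_arrow [simp]:
  assumes "f \<in> Ar C" "f' \<in> Ar C" "src C f = src C f'" "trg C f = trg C f'"
  shows "g \<in> Ar C \<Longrightarrow> src C g = trg C f' \<Longrightarrow> g \<cdot> hplus C f f' = hplus C (g \<cdot> f) (g \<cdot> f')"
    and "h \<in> Ar C \<Longrightarrow> trg C h = src C f' \<Longrightarrow> hplus C f f' \<cdot> h = hplus C (f \<cdot> h) (f' \<cdot> h)"
  using assms cmp_hplus_right[of f "src C f'" "trg C f'" f' g "trg C g"]
    cmp_hplus_left[of h "src C h" "src C f'" f "trg C f'" f'] by (auto simp: Hom_def)

lemma cmp_hzero [simp]:
  assumes "f \<in> Ar C"
  shows "W \<in> Ob C \<Longrightarrow> src C f = X \<Longrightarrow> f \<cdot> hzero C W X = hzero C W (trg C f)"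
    and "W \<in> Ob C \<Longrightarrow> trg C f = Y \<Longrightarrow> hzero C Y W \<cdot> f = hzero C (src C f) W"
proof -
  assume W: "W \<in> Ob C" and X: "src C f = X"
  have Ob: "X \<in> Ob C" "trg C f \<in> Ob C" using src_in_Ob[OF assms] trg_in_Ob[OF assms] X by auto
  let ?z = "hzero C W X"
  have "hplus C (f \<cdot> ?z) (f \<cdot> ?z) = f \<cdot> hplus C ?z ?z" using assms W X Ob by (simp del: hplus_hzero)
  also have "\<dots> = f \<cdot> ?z" using W Ob by simp
  finally have "hplus C (f \<cdot> ?z) (f \<cdot> ?z) = f \<cdot> ?z" .
  then show "f \<cdot> ?z = hzero C W (trg C f)"
    by (rule hplus_eq_self[rotated 2]) (use assms W X Ob in \<open>simp_all add: Hom_iff\<close>)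
next
  assume W: "W \<in> Ob C" and Y: "trg C f = Y"
  have Ob: "Y \<in> Ob C" "src C f \<in> Ob C" using src_in_Ob[OF assms] trg_in_Ob[OF assms] Y by auto
  let ?z = "hzero C Y W"
  have "hplus C (?z \<cdot> f) (?z \<cdot> f) = hplus C ?z ?z \<cdot> f" using assms W Y Ob by (simp del: hplus_hzero)
  also have "\<dots> = ?z \<cdot> f" using W Ob by simp
  finally have "hplus C (?z \<cdot> f) (?z \<cdot> f) = ?z \<cdot> f" .
  then show "?z \<cdot> f = hzero C (src C f) W"
    by (rule hplus_eq_self[rotated 2]) (use assms W Y Ob in \<open>simp_all add: Hom_iff\<close>)
qed

lemma ex_hminus:
  assumes "f \<in> Hom C X Y" "g \<in> Hom C X Y"
  obtains d where "d \<in> Hom C X Y" "hplus C d g = f"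
proof -
  interpret G: comm_group "Hom_group C X Y" using comm_group_Hom assms by (auto simp: Hom_iff)
  have c: "f \<in> carrier (Hom_group C X Y)" "g \<in> carrier (Hom_group C X Y)"
    using assms by (simp_all add: Hom_group_def)
  let ?d = "f \<otimes>\<^bsub>Hom_group C X Y\<^esub> inv\<^bsub>Hom_group C X Y\<^esub> g"
  have "?d \<in> carrier (Hom_group C X Y)" "?d \<otimes>\<^bsub>Hom_group C X Y\<^esub> g = f"
    using c by (auto simp: G.m_assoc)
  then show thesis by (intro that[of ?d]) (auto simp: Hom_group_def)
qed

lemma monoI:
  assumes f: "f \<in> Hom C X Y"
    and ker: "\<And>W g. g \<in> Hom C W X \<Longrightarrow> f \<cdot> g = hzero C W Y \<Longrightarrow> g = hzero C W X"
  shows "is_mono C f"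
  unfolding is_mono_def
proof (intro conjI allI ballI impI)
  fix W u v assume "u \<in> Hom C W (src C f)" "v \<in> Hom C W (src C f)" and eq: "f \<cdot> u = f \<cdot> v"
  then have uv: "u \<in> Hom C W X" "v \<in> Hom C W X" using f by (auto simp: Hom_iff)
  obtain d where d: "d \<in> Hom C W X" "hplus C d v = u" using ex_hminus[OF uv] by blast
  have "f \<cdot> hplus C d v = f \<cdot> v" using d eq by simp
  then have "hplus C (f \<cdot> d) (f \<cdot> v) = f \<cdot> v" using f d(1) uv by (simp add: Hom_iff)
  then have "f \<cdot> d = hzero C W Y"
    by (rule hplus_eq_self[rotated 2]) (use f d(1) uv in \<open>simp_all add: Hom_iff\<close>)
  from ker[OF d(1) this] show "u = v" using d uv by (auto simp: Hom_iff)
qed (use f in \<open>simp add: Hom_iff\<close>)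

lemma mono_cancel_zero:
  assumes "is_mono C f" "f \<in> Hom C X Y" "g \<in> Hom C W X" "f \<cdot> g = hzero C W Y"
  shows "g = hzero C W X"
  by (rule mono_cancel[OF assms(1-3)]) (use assms in \<open>simp_all add: Hom_iff\<close>)

lemma epi_cancel_zero:
  assumes "is_epi C f" "f \<in> Hom C X Y" "g \<in> Hom C Y W" "g \<cdot> f = hzero C X W"
  shows "g = hzero C Y W"
  by (rule epi_cancel[OF assms(1-3)]) (use assms in \<open>simp_all add: Hom_iff\<close>)

lemma kernel_Hom:
  assumes "is_kernel C f k" "f \<in> Hom C X Y"
  shows "k \<in> Hom C (src C k) X"
  using assms unfolding is_kernel_def Hom_def by auto

lemma kernel_zero:
  assumes "is_kernel C f k" "f \<in> Hom C X Y" "k \<in> Hom C K X"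
  shows "f \<cdot> k = hzero C K Y"
  using assms unfolding is_kernel_def Hom_def by auto

lemma kernel_factor:
  assumes "is_kernel C f k" "f \<in> Hom C X Y" "k \<in> Hom C K X" "w \<in> Hom C W X" "f \<cdot> w = hzero C W Y"
  obtains h where "h \<in> Hom C W K" "k \<cdot> h = w"
  using assms unfolding is_kernel_def Hom_def by blast

lemma kernel_mono:
  assumes "is_kernel C f k"
  shows "is_mono C k"
proof -
  have Ar: "f \<in> Ar C" "k \<in> Ar C" and t: "trg C k = src C f"
    and z: "f \<cdot> k = hzero C (src C k) (trg C f)"
    and u: "\<And>W g. g\<in>Hom C W (src C f) \<Longrightarrow> f \<cdot> g = hzero C W (trg C f) \<Longrightarrow>
        (\<exists>!h. h \<in> Hom C W (src C k) \<and> k \<cdot> h = g)"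
    using assms unfolding is_kernel_def by auto
  show ?thesis
    unfolding is_mono_def
  proof (intro conjI allI ballI impI)
    fix W g h assume gh: "g \<in> Hom C W (src C k)" "h \<in> Hom C W (src C k)" and eq: "k \<cdot> g = k \<cdot> h"
    have kg: "k \<cdot> g \<in> Hom C W (src C f)" using gh Ar t by (simp add: Hom_iff src_in_Ob)
    have "(f \<cdot> k) \<cdot> g = hzero C W (trg C f)"
      unfolding z using gh Ar by (simp add: Hom_iff trg_in_Ob)
    then have "f \<cdot> (k \<cdot> g) = hzero C W (trg C f)" using gh Ar t by (simp add: Hom_iff)
    from u[OF kg this] show "g = h" using gh eq by auto
  qed (rule Ar)
qed

lemma kernelI:
  assumes "f \<in> Hom C X Y" "k \<in> Hom C K X" "is_mono C k" "f \<cdot> k = hzero C K Y"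
    and "\<And>W w. w \<in> Hom C W X \<Longrightarrow> f \<cdot> w = hzero C W Y \<Longrightarrow> \<exists>h\<in>Hom C W K. k \<cdot> h = w"
  shows "is_kernel C f k"
  unfolding is_kernel_def
proof (intro conjI allI ballI impI)
  fix W g assume "g \<in> Hom C W (src C f)" "f \<cdot> g = hzero C W (trg C f)"
  then obtain h where "h \<in> Hom C W K" "k \<cdot> h = g" using assms(5)[of g W] assms(1) by (auto simp: Hom_iff)
  then show "\<exists>!h. h \<in> Hom C W (src C k) \<and> k \<cdot> h = g"
    using mono_cancel[OF assms(3,2)] assms(2) by (auto simp: Hom_iff)
qed (use assms in \<open>simp_all add: Hom_iff\<close>)

end

section \<open>The opposite category\<close>

definition op :: "('o, 'm) cat \<Rightarrow> ('o, 'm) cat" where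
  "op C = \<lparr>Ob = Ob C, Ar = Ar C, src = trg C, trg = src C, idt = idt C,
     cmp = (\<lambda>g f. cmp C f g), hplus = hplus C, hzero = (\<lambda>X Y. hzero C Y X)\<rparr>"

lemma op_simps [simp]:
  "Ob (op C) = Ob C" "Ar (op C) = Ar C" "src (op C) = trg C" "trg (op C) = src C"
  "idt (op C) = idt C" "cmp (op C) g f = cmp C f g" "hplus (op C) = hplus C"
  "hzero (op C) X Y = hzero C Y X"
  by (simp_all add: op_def)

lemma op_op: "op (op C) = C"
  by (simp add: op_def)

lemma Hom_op [simp]: "Hom (op C) X Y = Hom C Y X"
  by (auto simp: Hom_def)

lemma Hom_group_op [simp]: "Hom_group (op C) X Y = Hom_group C Y X"
  by (simp add: Hom_group_def)

lemma mono_epi_op [simp]: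
  "is_mono (op C) f \<longleftrightarrow> is_epi C f" "is_epi (op C) f \<longleftrightarrow> is_mono C f"
  by (simp_all add: is_mono_def is_epi_def)

lemma kernel_cokernel_op [simp]:
  "is_kernel (op C) f k \<longleftrightarrow> is_cokernel C f k" "is_cokernel (op C) f k \<longleftrightarrow> is_kernel C f k"
  by (simp_all add: is_kernel_def is_cokernel_def)

lemma zero_object_op [simp]: "zero_object (op C) Z \<longleftrightarrow> zero_object C Z"
  by (auto simp: zero_object_def)

lemma (in preadditive_category) biproduct_op: "is_biproduct (op C) X Y S \<longleftrightarrow> is_biproduct C X Y S"
proof -
  have *: "is_biproduct D X Y S" if "is_biproduct (op D) X Y S" for D :: "('a, 'b) cat"
    using that unfolding is_biproduct_def op_simps Hom_op by blast
  show ?thesis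
    using *[of C] *[of "op C"] unfolding op_op by blast
qed

lemma (in abelian_category) abelian_category_op: "abelian_category (op C)"
  by (intro abelian_category.intro additive_category.intro preadditive_category.intro category.intro
      abelian_category_axioms.intro additive_category_axioms.intro preadditive_category_axioms.intro)
    (auto simp: src_in_Ob trg_in_Ob comm_group_Hom idt_in_Hom biproduct_op
      intro: cmp_in_Hom cmp_idt_right cmp_idt_left cmp_assoc[symmetric] cmp_hplus_left
        cmp_hplus_right ex_zero_object ex_biproduct ex_kernel ex_cokernel mono_is_kernel
        epi_is_cokernel)

section \<open>Short exact sequences\<close>

definition ses :: "('o, 'm) cat \<Rightarrow> 'o \<Rightarrow> 'm \<Rightarrow> 'o \<Rightarrow> 'm \<Rightarrow> 'o \<Rightarrow> bool" where
  "ses C X f Y g Z \<longleftrightarrow>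
     f \<in> Hom C X Y \<and> g \<in> Hom C Y Z \<and> is_kernel C g f \<and> is_cokernel C f g"

lemma ses_op [simp]: "ses (op C) Z g Y f X \<longleftrightarrow> ses C X f Y g Z"
  by (auto simp: ses_def)

definition biproduct_maps ::
  "('o, 'm) cat \<Rightarrow> 'o \<Rightarrow> 'o \<Rightarrow> 'o \<Rightarrow> 'm \<Rightarrow> 'm \<Rightarrow> 'm \<Rightarrow> 'm \<Rightarrow> bool" where
  "biproduct_maps C X Y S i j p q \<longleftrightarrow>
     i \<in> Hom C X S \<and> j \<in> Hom C Y S \<and> p \<in> Hom C S X \<and> q \<in> Hom C S Y \<and>
     p \<cdot>\<^bsub>C\<^esub> i = idt C X \<and> q \<cdot>\<^bsub>C\<^esub> j = idt C Y \<and>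
     q \<cdot>\<^bsub>C\<^esub> i = hzero C X Y \<and> p \<cdot>\<^bsub>C\<^esub> j = hzero C Y X \<and>
     hplus C (i \<cdot>\<^bsub>C\<^esub> p) (j \<cdot>\<^bsub>C\<^esub> q) = idt C S"

lemma is_biproduct_iff: "is_biproduct C X Y S \<longleftrightarrow> (\<exists>i j p q. biproduct_maps C X Y S i j p q)"
  unfolding is_biproduct_def biproduct_maps_def by blast

context abelian_category
begin

lemma Hom_Ob:
  assumes "f \<in> Hom C X Y" shows "X \<in> Ob C" "Y \<in> Ob C"
  using assms by (simp_all add: Hom_iff)

lemma epiI:
  assumes "f \<in> Hom C X Y"
    and "\<And>W g. g \<in> Hom C Y W \<Longrightarrow> g \<cdot> f = hzero C X W \<Longrightarrow> g = hzero C Y W"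
  shows "is_epi C f"
proof -
  interpret op: abelian_category "op C" by (rule abelian_category_op)
  show ?thesis using op.monoI[of f Y X] assms by simp
qed

lemma epi_comp:
  assumes "is_epi C f" "is_epi C g" "f \<in> Hom C X Y" "g \<in> Hom C Y Z"
  shows "is_epi C (g \<cdot> f)"
proof -
  interpret op: abelian_category "op C" by (rule abelian_category_op)
  show ?thesis using op.mono_comp[of g f Z Y X] assms by simp
qed

lemma epi_left_factor:
  assumes "is_epi C (g \<cdot> f)" "f \<in> Hom C X Y" "g \<in> Hom C Y Z"
  shows "is_epi C g"
proof -
  interpret op: abelian_category "op C" by (rule abelian_category_op)
  show ?thesis using op.mono_right_factor[of f g Z Y X] assms by simp
qed

lemma split_epi:
  assumes "f \<in> Hom C X Y" "g \<in> Hom C Y X" "f \<cdot> g = idt C Y"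
  shows "is_epi C f"
proof -
  interpret op: abelian_category "op C" by (rule abelian_category_op)
  show ?thesis using op.split_mono[of f Y X g] assms by simp
qed

lemma cokernel_Hom:
  assumes "is_cokernel C f c" "f \<in> Hom C X Y"
  shows "c \<in> Hom C Y (trg C c)"
  using assms unfolding is_cokernel_def Hom_def by auto

lemma cokernel_zero:
  assumes "is_cokernel C f c" "f \<in> Hom C X Y" "c \<in> Hom C Y Q"
  shows "c \<cdot> f = hzero C X Q"
  using assms unfolding is_cokernel_def Hom_def by auto

lemma cokernel_factor:
  assumes "is_cokernel C f c" "f \<in> Hom C X Y" "c \<in> Hom C Y Q" "w \<in> Hom C Y W" "w \<cdot> f = hzero C X W"
  obtains h where "h \<in> Hom C Q W" "h \<cdot> c = w"
  using assms unfolding is_cokernel_def Hom_def by blast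

lemma cokernel_epi:
  assumes "is_cokernel C f c"
  shows "is_epi C c"
proof -
  interpret op: abelian_category "op C" by (rule abelian_category_op)
  show ?thesis using op.kernel_mono[of f c] assms by simp
qed

lemma mono_is_kernel_of_cokernel:
  assumes "is_mono C f" "is_cokernel C f c"
  shows "is_kernel C c f"
proof -
  obtain X Y where f: "f \<in> Hom C X Y" using assms(2) ArE unfolding is_cokernel_def by blast
  obtain Q where c: "c \<in> Hom C Y Q" using cokernel_Hom[OF assms(2) f] by blast
  obtain g where g: "is_kernel C g f" using mono_is_kernel[OF assms(1)] by blast
  obtain Z where gh: "g \<in> Hom C Y Z"
    using g f unfolding is_kernel_def by (auto simp: Hom_def)
  obtain h where h: "h \<in> Hom C Q Z" "h \<cdot> c = g"
    using cokernel_factor[OF assms(2) f c gh kernel_zero[OF g gh f]] by blast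
  show ?thesis
  proof (rule kernelI[OF c f assms(1) cokernel_zero[OF assms(2) f c]])
    fix W w assume w: "w \<in> Hom C W Y" and z: "c \<cdot> w = hzero C W Q"
    have "(h \<cdot> c) \<cdot> w = h \<cdot> (c \<cdot> w)" by (rule cmp_assoc[OF w c h(1)])
    then have "g \<cdot> w = hzero C W Z" using h w z by (simp add: Hom_iff)
    then show "\<exists>h\<in>Hom C W X. f \<cdot> h = w" using kernel_factor[OF g gh f w] by blast
  qed
qed

lemma epi_is_cokernel_of_kernel:
  assumes "is_epi C f" "is_kernel C f k"
  shows "is_cokernel C k f"
proof -
  interpret op: abelian_category "op C" by (rule abelian_category_op)
  show ?thesis using op.mono_is_kernel_of_cokernel[of f k] assms by simp
qed

lemma epi_kernel_ses:
  assumes "is_epi C g" "g \<in> Hom C Y Z" "is_kernel C g f" "f \<in> Hom C X Y"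
  shows "ses C X f Y g Z"
  unfolding ses_def using assms epi_is_cokernel_of_kernel by blast

lemma epi_ses:
  assumes "is_epi C g" "g \<in> Hom C Y Z"
  obtains X f where "ses C X f Y g Z"
proof -
  obtain f where f: "is_kernel C g f" using ex_kernel assms(2) by (auto simp: Hom_def)
  show thesis using that[OF epi_kernel_ses[OF assms f kernel_Hom[OF f assms(2)]]] .
qed

lemma mono_ses:
  assumes "is_mono C f" "f \<in> Hom C X Y"
  obtains Z g where "ses C X f Y g Z"
proof -
  interpret op: abelian_category "op C" by (rule abelian_category_op)
  show thesis using op.epi_ses[of f Y X] assms that by auto
qed

lemma sesD:
  assumes "ses C X f Y g Z"
  shows "f \<in> Hom C X Y" "g \<in> Hom C Y Z" "g \<cdot> f = hzero C X Z" "is_mono C f" "is_epi C g"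
    "X \<in> Ob C" "Y \<in> Ob C" "Z \<in> Ob C"
  using assms kernel_zero[of g f Y Z X] kernel_mono[of g f] cokernel_epi[of f g]
  by (auto simp: ses_def Hom_iff)

lemma ses_lift:
  assumes "ses C X f Y g Z" "w \<in> Hom C W Y" "g \<cdot> w = hzero C W Z"
  obtains h where "h \<in> Hom C W X" "f \<cdot> h = w"
  using assms kernel_factor[of g f Y Z X w W] unfolding ses_def by blast

lemma ses_descend:
  assumes "ses C X f Y g Z" "w \<in> Hom C Y W" "w \<cdot> f = hzero C X W"
  obtains h where "h \<in> Hom C Z W" "h \<cdot> g = w"
  using assms cokernel_factor[of f g X Y Z w W] unfolding ses_def by blast

lemma sesI:
  assumes "f \<in> Hom C X Y" "g \<in> Hom C Y Z" "is_mono C f" "is_epi C g" "g \<cdot> f = hzero C X Z"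
    and "\<And>W w. w \<in> Hom C W Y \<Longrightarrow> g \<cdot> w = hzero C W Z \<Longrightarrow> \<exists>h\<in>Hom C W X. f \<cdot> h = w"
  shows "ses C X f Y g Z"
  using epi_kernel_ses[OF assms(4,2) kernelI[OF assms(2,1,3,5,6)] assms(1)] .

lemma mono_epi_inverse:
  assumes "is_mono C f" "is_epi C f" "f \<in> Hom C X Y"
  obtains g where "g \<in> Hom C Y X" "f \<cdot> g = idt C Y" "g \<cdot> f = idt C X"
proof -
  obtain Z c where s: "ses C X f Y c Z" using mono_ses[OF assms(1,3)] .
  note c = sesD[OF s]
  have "c = hzero C Y Z" by (rule epi_cancel_zero[OF assms(2,3) c(2,3)])
  then have z: "c \<cdot> idt C Y = hzero C Y Z" using c(2) by (simp add: Hom_iff)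
  obtain g where g: "g \<in> Hom C Y X" "f \<cdot> g = idt C Y"
    using ses_lift[OF s idt_in_Hom[OF c(7)] z] .
  have "f \<cdot> (g \<cdot> f) = (f \<cdot> g) \<cdot> f" by (rule cmp_assoc[symmetric, OF assms(3) g(1) assms(3)])
  also have "\<dots> = f \<cdot> idt C X" unfolding g(2) using assms(3) by (simp add: Hom_iff)
  finally have "f \<cdot> (g \<cdot> f) = f \<cdot> idt C X" .
  then have "g \<cdot> f = idt C X"
    by (rule mono_cancel[OF assms(1,3) cmp_in_Hom[OF assms(3) g(1)] idt_in_Hom[OF Hom_Ob(1)[OF assms(3)]]])
  with g show thesis by (rule that)
qed

lemma is_isoI:
  assumes "is_mono C f" "is_epi C f"
  shows "is_iso C f"
proof -
  obtain X Y where f: "f \<in> Hom C X Y" using assms(1) ArE unfolding is_mono_def by blast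
  obtain g where g: "g \<in> Hom C Y X" "f \<cdot> g = idt C Y" "g \<cdot> f = idt C X"
    using mono_epi_inverse[OF assms f] .
  show ?thesis unfolding is_iso_def using f g by (intro conjI bexI[of _ g]) (simp_all add: Hom_def)
qed

text \<open>If \<open>e\<close> were not epi, \<open>f\<close> would factor through the subobject \<open>m \<cdot> ker u\<close> of \<open>I\<close>, which is itself
  a kernel and so cannot be smaller than \<open>ker (coker f)\<close>.\<close>

lemma image_factorization:
  assumes f: "f \<in> Hom C X Y" and c: "is_cokernel C f c" and m: "is_kernel C c m" "m \<in> Hom C I Y"
  obtains e where "e \<in> Hom C X I" "is_epi C e" "m \<cdot> e = f"
proof -
  obtain Q where cQ: "c \<in> Hom C Y Q" using cokernel_Hom[OF c f] by blast
  note mm = kernel_mono[OF m(1)]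
  obtain e where e: "e \<in> Hom C X I" "m \<cdot> e = f"
    using kernel_factor[OF m(1) cQ m(2) f cokernel_zero[OF c f cQ]] .
  have "is_epi C e"
  proof (rule epiI[OF e(1)])
    fix W u assume u: "u \<in> Hom C I W" and z: "u \<cdot> e = hzero C X W"
    obtain k where k: "is_kernel C u k" using ex_kernel u by (auto simp: Hom_def)
    obtain J where kJ: "k \<in> Hom C J I" using kernel_Hom[OF k u] by blast
    obtain e' where e': "e' \<in> Hom C X J" "k \<cdot> e' = e" using kernel_factor[OF k u kJ e(1) z] .
    have mk: "m \<cdot> k \<in> Hom C J Y" using kJ m(2) by (simp add: Hom_iff)
    have mmk: "is_mono C (m \<cdot> k)" by (rule mono_comp[OF kernel_mono[OF k] mm kJ m(2)])
    obtain Z y where s: "ses C J (m \<cdot> k) Y y Z" using mono_ses[OF mmk mk] .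
    note y = sesD[OF s]
    have "y \<cdot> f = (y \<cdot> (m \<cdot> k)) \<cdot> e'" 
      using cmp_assoc[OF e'(1) mk y(2)] cmp_assoc[OF e'(1) kJ m(2)] e'(2) e(2) by simp
    also have "\<dots> = hzero C X Z" unfolding y(3) using y(8) e'(1) by (simp add: Hom_iff)
    finally obtain v where v: "v \<in> Hom C Q Z" "v \<cdot> c = y"
      by (rule cokernel_factor[OF c f cQ y(2)])
    have "y \<cdot> m = v \<cdot> (c \<cdot> m)" using cmp_assoc[OF m(2) cQ v(1)] v(2) by simp
    also have "\<dots> = hzero C I Z"
      unfolding kernel_zero[OF m(1) cQ m(2)] using v(1) m(2) by (simp add: Hom_iff)
    finally obtain t where t: "t \<in> Hom C I J" "(m \<cdot> k) \<cdot> t = m"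
      by (rule ses_lift[OF s m(2)])
    have "m \<cdot> (k \<cdot> t) = m \<cdot> idt C I" 
      using cmp_assoc[OF t(1) kJ m(2)] t(2) m(2) by (simp add: Hom_iff)
    then have kt: "k \<cdot> t = idt C I"
      by (rule mono_cancel[OF mm m(2) cmp_in_Hom[OF t(1) kJ] idt_in_Hom[OF Hom_Ob(2)[OF kJ]]])
    have "u \<cdot> (k \<cdot> t) = (u \<cdot> k) \<cdot> t" by (rule cmp_assoc[symmetric, OF t(1) kJ u])
    also have "\<dots> = hzero C I W"
      unfolding kernel_zero[OF k u kJ] using u t(1) by (simp add: Hom_iff)
    finally show "u = hzero C I W" unfolding kt using u by (simp add: Hom_iff)
  qed
  with e(1) show thesis using e(2) by (rule that)
qed

section \<open>Diagram lemmas\<close>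

lemma biproduct_maps_swap:
  assumes "biproduct_maps C X Y S i j p q"
  shows "biproduct_maps C Y X S j i q p"
  using assms hplus_comm[of "i \<cdot> p" S S "j \<cdot> q"] by (auto simp: biproduct_maps_def cmp_in_Hom Hom_iff)

lemma ex_biproduct_maps:
  assumes "X \<in> Ob C" "Y \<in> Ob C"
  obtains S i j p q where "S \<in> Ob C" "biproduct_maps C X Y S i j p q"
  using ex_biproduct[OF assms] unfolding is_biproduct_iff by blast

lemma biproduct_maps_decomp:
  assumes "biproduct_maps C X Y S i j p q" "w \<in> Hom C W S"
  shows "hplus C (i \<cdot> (p \<cdot> w)) (j \<cdot> (q \<cdot> w)) = w"
proof -
  have "i \<in> Hom C X S" "j \<in> Hom C Y S" "p \<in> Hom C S X" "q \<in> Hom C S Y"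
    using assms(1) by (auto simp: biproduct_maps_def)
  then have "hplus C (i \<cdot> (p \<cdot> w)) (j \<cdot> (q \<cdot> w)) = hplus C (i \<cdot> p) (j \<cdot> q) \<cdot> w"
    using assms(2) by (simp add: Hom_iff)
  also have "hplus C (i \<cdot> p) (j \<cdot> q) = idt C S" using assms(1) by (simp add: biproduct_maps_def)
  finally show ?thesis using assms(2) by (simp add: Hom_iff)
qed

lemma biproduct_ses:
  assumes "biproduct_maps C X Y S i j p q"
  shows "ses C X i S q Y"
proof (rule sesI)
  have b: "i \<in> Hom C X S" "j \<in> Hom C Y S" "p \<in> Hom C S X" "q \<in> Hom C S Y"
    "p \<cdot> i = idt C X" "q \<cdot> j = idt C Y" "q \<cdot> i = hzero C X Y"
    using assms by (auto simp: biproduct_maps_def)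
  show "i \<in> Hom C X S" "q \<in> Hom C S Y" "q \<cdot> i = hzero C X Y" by fact+
  show "is_mono C i" by (rule split_mono[OF b(1,3,5)])
  show "is_epi C q" by (rule split_epi[OF b(4,2,6)])
  fix W w assume w: "w \<in> Hom C W S" and z: "q \<cdot> w = hzero C W Y"
  have "i \<cdot> (p \<cdot> w) = w" using biproduct_maps_decomp[OF assms w] z b w by (simp add: Hom_iff)
  then show "\<exists>h\<in>Hom C W X. i \<cdot> h = w" using cmp_in_Hom[OF w b(3)] by blast
qed

text \<open>The pullback of \<open>\<phi>\<close> and \<open>- \<psi>\<close>, realised as the kernel of \<open>(\<phi>, \<psi>) : X \<oplus> Y \<rightarrow> M\<close>. The sign of \<open>\<psi>\<close>
  does not matter, and leaving it out keeps the two factors symmetric.\<close>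

lemma biproduct_pullback:
  assumes bp: "biproduct_maps C X Y S i j p q"
    and s: "ses C K k X \<phi> M" and psi: "\<psi> \<in> Hom C Y M"
    and n: "is_kernel C (hplus C (\<phi> \<cdot> p) (\<psi> \<cdot> q)) n" "n \<in> Hom C P S"
  obtains k' where "ses C K k' P (q \<cdot> n) Y"
proof -
  have b: "i \<in> Hom C X S" "j \<in> Hom C Y S" "p \<in> Hom C S X" "q \<in> Hom C S Y"
    "p \<cdot> i = idt C X" "q \<cdot> j = idt C Y" "q \<cdot> i = hzero C X Y" "p \<cdot> j = hzero C Y X"
    using bp by (auto simp: biproduct_maps_def)
  note s' = sesD[OF s]
  let ?h = "hplus C (\<phi> \<cdot> p) (\<psi> \<cdot> q)"
  have h: "?h \<in> Hom C S M" using b s' psi by (simp add: Hom_iff)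
  have h_eq: "?h \<cdot> w = hplus C (\<phi> \<cdot> (p \<cdot> w)) (\<psi> \<cdot> (q \<cdot> w))" if "w \<in> Hom C W S" for w W
    using that b s' psi by (simp add: Hom_iff)
  have hi: "?h \<cdot> i = \<phi>" using h_eq[OF b(1)] b s' psi by (simp add: Hom_iff)
  have qn: "q \<cdot> n \<in> Hom C P Y" by (rule cmp_in_Hom[OF n(2) b(4)])
  have pn: "p \<cdot> n \<in> Hom C P X" by (rule cmp_in_Hom[OF n(2) b(3)])
  have epi_h: "is_epi C ?h"
    by (rule epi_left_factor[OF _ b(1) h]) (simp add: hi s')
  have sh: "ses C P n S ?h M" by (rule epi_kernel_ses[OF epi_h h n])
  have ik: "i \<cdot> k \<in> Hom C K S" by (rule cmp_in_Hom[OF s'(1) b(1)])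
  have "?h \<cdot> (i \<cdot> k) = (?h \<cdot> i) \<cdot> k" by (rule cmp_assoc[symmetric, OF s'(1) b(1) h])
  then have "?h \<cdot> (i \<cdot> k) = hzero C K M" unfolding hi using s' by simp
  then obtain k' where k': "k' \<in> Hom C K P" "n \<cdot> k' = i \<cdot> k" by (rule ses_lift[OF sh ik])
  have "(p \<cdot> n) \<cdot> k' = p \<cdot> (i \<cdot> k)" using n(2) b k' by (simp add: Hom_iff)
  also have "\<dots> = (p \<cdot> i) \<cdot> k" by (rule cmp_assoc[symmetric, OF s'(1) b(1,3)])
  finally have pnk: "(p \<cdot> n) \<cdot> k' = k" using b s' by (simp add: Hom_iff)
  have "ses C K k' P (q \<cdot> n) Y"
  proof (rule sesI[OF k'(1) qn])
    show "is_mono C k'" by (rule mono_right_factor[OF _ k'(1) pn]) (simp add: pnk s')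
    have "(q \<cdot> n) \<cdot> k' = (q \<cdot> i) \<cdot> k"
      using cmp_assoc[OF k'(1) n(2) b(4)] cmp_assoc[OF s'(1) b(1,4)] k'(2) by simp
    also have "\<dots> = hzero C K Y" using b s' by (simp add: Hom_iff)
    finally show "(q \<cdot> n) \<cdot> k' = hzero C K Y" .
    show "is_epi C (q \<cdot> n)"
    proof (rule epiI[OF qn])
      fix W u assume u: "u \<in> Hom C Y W" and "u \<cdot> (q \<cdot> n) = hzero C P W"
      then have z: "(u \<cdot> q) \<cdot> n = hzero C P W" using n(2) b by (simp add: Hom_iff)
      obtain v where v: "v \<in> Hom C M W" "v \<cdot> ?h = u \<cdot> q"
        using ses_descend[OF sh cmp_in_Hom[OF b(4) u] z] .
      have "v \<cdot> \<phi> = (v \<cdot> ?h) \<cdot> i" using hi cmp_assoc[OF b(1) h v(1)] by simp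
      also have "\<dots> = u \<cdot> (q \<cdot> i)" unfolding v(2) using b u by (simp add: Hom_iff)
      also have "\<dots> = hzero C X W" using b u by (simp add: Hom_iff)
      finally have "v = hzero C M W" using epi_cancel_zero[OF s'(5,2) v(1)] by blast
      then have uq: "u \<cdot> q = hzero C S W" using v h by (simp add: Hom_iff)
      have "u = (u \<cdot> q) \<cdot> j" using u b by (simp add: Hom_iff)
      then show "u = hzero C Y W" unfolding uq using b u by (simp add: Hom_iff)
    qed
  next
    fix W w assume w: "w \<in> Hom C W P" and z: "(q \<cdot> n) \<cdot> w = hzero C W Y"
    have nw: "n \<cdot> w \<in> Hom C W S" by (rule cmp_in_Hom[OF w n(2)])
    have qnw: "q \<cdot> (n \<cdot> w) = hzero C W Y" using z w n(2) b by (simp add: Hom_iff)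
    have "?h \<cdot> (n \<cdot> w) = (?h \<cdot> n) \<cdot> w" by (rule cmp_assoc[symmetric, OF w n(2) h])
    also have "\<dots> = hzero C W M" unfolding sesD(3)[OF sh] using s' w by (simp add: Hom_iff)
    finally have "?h \<cdot> (n \<cdot> w) = hzero C W M" .
    then have "\<phi> \<cdot> (p \<cdot> (n \<cdot> w)) = hzero C W M"
      unfolding h_eq[OF nw] qnw using psi s' b nw by (simp add: Hom_iff)
    then obtain c where c: "c \<in> Hom C W K" "k \<cdot> c = p \<cdot> (n \<cdot> w)"
      by (rule ses_lift[OF s cmp_in_Hom[OF nw b(3)]])
    have "n \<cdot> (k' \<cdot> c) = (n \<cdot> k') \<cdot> c" by (rule cmp_assoc[symmetric, OF c(1) k'(1) n(2)])
    also have "\<dots> = i \<cdot> (p \<cdot> (n \<cdot> w))"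
      unfolding k'(2) using cmp_assoc[OF c(1) s'(1) b(1)] c(2) by simp
    also have "\<dots> = n \<cdot> w"
      using biproduct_maps_decomp[OF bp nw] qnw b nw by (simp add: Hom_iff)
    finally have "k' \<cdot> c = w"
      by (rule mono_cancel[OF sesD(4)[OF sh] n(2) cmp_in_Hom[OF c(1) k'(1)] w])
    then show "\<exists>h\<in>Hom C W K. k' \<cdot> h = w" using c by blast
  qed
  then show thesis by (rule that)
qed

lemma pullback_ses:
  assumes s: "ses C K k X \<phi> M" and t: "ses C L l Y \<psi> M"
  obtains P k' b l' a where "ses C K k' P b Y" "ses C L l' P a X"
proof -
  note s' = sesD[OF s] and t' = sesD[OF t]
  obtain S i j p q where bp: "biproduct_maps C X Y S i j p q"
    using ex_biproduct_maps[OF s'(7) t'(7)] .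
  then have pq: "p \<in> Hom C S X" "q \<in> Hom C S Y" by (auto simp: biproduct_maps_def)
  have h: "hplus C (\<phi> \<cdot> p) (\<psi> \<cdot> q) \<in> Hom C S M" using pq s' t' by (simp add: Hom_iff)
  have h': "hplus C (\<psi> \<cdot> q) (\<phi> \<cdot> p) = hplus C (\<phi> \<cdot> p) (\<psi> \<cdot> q)"
    by (rule hplus_comm) (use pq s' t' in \<open>auto intro: cmp_in_Hom\<close>)
  obtain n where n: "is_kernel C (hplus C (\<phi> \<cdot> p) (\<psi> \<cdot> q)) n"
    using ex_kernel h by (auto simp: Hom_def)
  note n' = kernel_Hom[OF n h]
  obtain k' where k': "ses C K k' (src C n) (q \<cdot> n) Y"
    using biproduct_pullback[OF bp s t'(2) n n'] .
  obtain l' where l': "ses C L l' (src C n) (p \<cdot> n) X"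
    using biproduct_pullback[OF biproduct_maps_swap[OF bp] t s'(2) n[folded h'] n'] .
  show thesis by (rule that[OF k' l'])
qed

lemma pushout_ses:
  assumes "ses C X f Y g K" "ses C X f' Y' g' L"
  obtains P a b a' b' where "ses C Y' a P b K" "ses C Y a' P b' L"
proof -
  interpret op: abelian_category "op C" by (rule abelian_category_op)
  show thesis
    by (rule op.pullback_ses[of K g Y f X L g' Y' f']) (simp_all add: assms, blast intro: that)
qed

lemma epi_comp_ses:
  assumes s: "ses C K k A e B" and t: "ses C D l B e' E"
  obtains N n k' r where "ses C N n A (e' \<cdot> e) E" "ses C K k' N r D"
proof -
  note s' = sesD[OF s] and t' = sesD[OF t]
  have ee: "e' \<cdot> e \<in> Hom C A E" by (rule cmp_in_Hom[OF s'(2) t'(2)])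
  obtain N n where u: "ses C N n A (e' \<cdot> e) E"
    using epi_ses[OF epi_comp[OF s'(5) t'(5) s'(2) t'(2)] ee] .
  note u' = sesD[OF u]
  have en: "e \<cdot> n \<in> Hom C N B" by (rule cmp_in_Hom[OF u'(1) s'(2)])
  have "e' \<cdot> (e \<cdot> n) = hzero C N E" using u'(3) cmp_assoc[OF u'(1) s'(2) t'(2)] by simp
  then obtain r where r: "r \<in> Hom C N D" "l \<cdot> r = e \<cdot> n" by (rule ses_lift[OF t en])
  obtain c where c: "is_cokernel C (e \<cdot> n) c" using ex_cokernel en by (auto simp: Hom_def)
  define Q where "Q = trg C c"
  have cQ: "c \<in> Hom C B Q" using cokernel_Hom[OF c en] by (simp add: Q_def)
  obtain m where m: "is_kernel C c m" using ex_kernel cQ by (auto simp: Hom_def)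
  obtain I where mI: "m \<in> Hom C I B" using kernel_Hom[OF m cQ] by blast
  obtain x where x: "x \<in> Hom C N I" "is_epi C x" "m \<cdot> x = e \<cdot> n"
    using image_factorization[OF en c m mI] .
  have "(c \<cdot> e) \<cdot> n = hzero C N Q"
    using cokernel_zero[OF c en cQ] cmp_assoc[OF u'(1) s'(2) cQ] by simp
  then obtain v where v: "v \<in> Hom C E Q" "v \<cdot> (e' \<cdot> e) = c \<cdot> e"
    by (rule ses_descend[OF u cmp_in_Hom[OF s'(2) cQ]])
  have "(v \<cdot> e') \<cdot> e = c \<cdot> e" using v cmp_assoc[OF s'(2) t'(2) v(1)] by simp
  then have ve: "v \<cdot> e' = c" using epi_cancel[OF s'(5,2) cmp_in_Hom[OF t'(2) v(1)] cQ] by blast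
  have "c \<cdot> l = hzero C D Q"
    unfolding ve[symmetric] using cmp_assoc[OF t'(1,2) v(1)] t' v by (simp add: Hom_iff)
  then obtain y where y: "y \<in> Hom C D I" "m \<cdot> y = l" by (rule kernel_factor[OF m cQ mI t'(1)])
  have "m \<cdot> (y \<cdot> r) = m \<cdot> x" using y r x cmp_assoc[OF r(1) y(1) mI] by simp
  then have yr: "y \<cdot> r = x" by (rule mono_cancel[OF kernel_mono[OF m] mI cmp_in_Hom[OF r(1) y(1)] x(1)])
  have epi_y: "is_epi C y" by (rule epi_left_factor[OF _ r(1) y(1)]) (simp add: yr x)
  have mono_y: "is_mono C y" by (rule mono_right_factor[OF _ y(1) mI]) (simp add: y t')
  obtain z where z: "z \<in> Hom C I D" "y \<cdot> z = idt C I" "z \<cdot> y = idt C D"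
    using mono_epi_inverse[OF mono_y epi_y y(1)] .
  have "z \<cdot> x = (z \<cdot> y) \<cdot> r" unfolding yr[symmetric] by (rule cmp_assoc[symmetric, OF r(1) y(1) z(1)])
  then have zx: "z \<cdot> x = r" using z r by (simp add: Hom_iff)
  have epi_r: "is_epi C r"
    unfolding zx[symmetric] by (rule epi_comp[OF x(2) split_epi[OF z(1) y(1) z(3)] x(1) z(1)])
  have "(e' \<cdot> e) \<cdot> k = hzero C K E" using cmp_assoc[OF s'(1,2) t'(2)] s' t' by (simp add: Hom_iff)
  then obtain k' where k': "k' \<in> Hom C K N" "n \<cdot> k' = k" by (rule ses_lift[OF u s'(1)])
  have "ses C K k' N r D"
  proof (rule sesI[OF k'(1) r(1) _ epi_r])
    show "is_mono C k'" by (rule mono_right_factor[OF _ k'(1) u'(1)]) (simp add: k' s')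
    have "l \<cdot> (r \<cdot> k') = (e \<cdot> n) \<cdot> k'" using cmp_assoc[OF k'(1) r(1) t'(1)] r by simp
    also have "\<dots> = hzero C K B" using cmp_assoc[OF k'(1) u'(1) s'(2)] k' s' by simp
    finally show "r \<cdot> k' = hzero C K D"
      by (rule mono_cancel_zero[OF t'(4,1) cmp_in_Hom[OF k'(1) r(1)]])
    fix W w assume w: "w \<in> Hom C W N" and z: "r \<cdot> w = hzero C W D"
    have nw: "n \<cdot> w \<in> Hom C W A" by (rule cmp_in_Hom[OF w u'(1)])
    have "e \<cdot> (n \<cdot> w) = (l \<cdot> r) \<cdot> w" using cmp_assoc[OF w u'(1) s'(2)] r by simp
    also have "\<dots> = hzero C W B" using cmp_assoc[OF w r(1) t'(1)] z t' w by (simp add: Hom_iff)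
    finally obtain h where h: "h \<in> Hom C W K" "k \<cdot> h = n \<cdot> w" by (rule ses_lift[OF s nw])
    have "n \<cdot> (k' \<cdot> h) = n \<cdot> w" using cmp_assoc[OF h(1) k'(1) u'(1)] k' h by simp
    then have "k' \<cdot> h = w" by (rule mono_cancel[OF u'(4,1) cmp_in_Hom[OF h(1) k'(1)] w])
    then show "\<exists>h\<in>Hom C W K. k' \<cdot> h = w" using h by blast
  qed
  with u show thesis by (rule that)
qed

lemma mono_comp_ses:
  assumes "ses C A f B g K" "ses C B f' D g' E"
  obtains n N r k where "ses C A (f' \<cdot> f) D n N" "ses C K r N k E"
proof -
  interpret op: abelian_category "op C" by (rule abelian_category_op)
  show thesis
    by (rule op.epi_comp_ses[of E g' D f' B K g f A]) (simp_all add: assms, blast intro: that)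
qed

lemma projective_lift:
  assumes "projective C P" "is_epi C e" "e \<in> Hom C Y Z" "f \<in> Hom C P Z"
  obtains g where "g \<in> Hom C P Y" "e \<cdot> g = f"
proof -
  have "trg C e = Z" "src C e = Y" using assms(3) by (auto simp: Hom_def)
  then show thesis using assms that unfolding projective_def by blast
qed

lemma horseshoe_step:
  assumes s: "ses C L' b Y a L" and t: "ses C L k P e E" and E: "projective C E"
  obtains S i q b' h where "ses C Y i S q E" "ses C L' b' S h P"
proof -
  note s' = sesD[OF s] and t' = sesD[OF t]
  obtain \<sigma> where sg: "\<sigma> \<in> Hom C E P" "e \<cdot> \<sigma> = idt C E"
    using projective_lift[OF E t'(5,2) idt_in_Hom[OF t'(8)]] .
  obtain S i j p q where bp: "biproduct_maps C Y E S i j p q"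
    using ex_biproduct_maps[OF s'(7) t'(8)] .
  then have m: "i \<in> Hom C Y S" "j \<in> Hom C E S" "p \<in> Hom C S Y" "q \<in> Hom C S E"
    "p \<cdot> i = idt C Y" "q \<cdot> j = idt C E" "q \<cdot> i = hzero C Y E" "p \<cdot> j = hzero C E Y"
    by (auto simp: biproduct_maps_def)
  have ka: "k \<cdot> a \<in> Hom C Y P" by (rule cmp_in_Hom[OF s'(2) t'(1)])
  let ?h = "hplus C ((k \<cdot> a) \<cdot> p) (\<sigma> \<cdot> q)"
  have h: "?h \<in> Hom C S P"
    by (rule hplus_in_Hom) (use ka m sg in \<open>auto intro: cmp_in_Hom\<close>)
  have h_eq: "?h \<cdot> w = hplus C (k \<cdot> (a \<cdot> (p \<cdot> w))) (\<sigma> \<cdot> (q \<cdot> w))" if "w \<in> Hom C W S" for w W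
    using that m s' t' sg by (simp add: Hom_iff)
  have hi: "?h \<cdot> i = k \<cdot> a" using h_eq[OF m(1)] m s' t' sg by (simp add: Hom_iff)
  have hj: "?h \<cdot> j = \<sigma>" using h_eq[OF m(2)] m s' t' sg by (simp add: Hom_iff)
  have ib: "i \<cdot> b \<in> Hom C L' S" by (rule cmp_in_Hom[OF s'(1) m(1)])
  have "ses C L' (i \<cdot> b) S ?h P"
  proof (rule sesI[OF ib h])
    show "is_mono C (i \<cdot> b)" by (rule mono_comp[OF s'(4) split_mono[OF m(1,3,5)] s'(1) m(1)])
    have "?h \<cdot> (i \<cdot> b) = (k \<cdot> a) \<cdot> b" using cmp_assoc[OF s'(1) m(1) h] hi by simp
    also have "\<dots> = hzero C L' P" using cmp_assoc[OF s'(1,2) t'(1)] s' t' by (simp add: Hom_iff)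
    finally show "?h \<cdot> (i \<cdot> b) = hzero C L' P" .
    show "is_epi C ?h"
    proof (rule epiI[OF h])
      fix W u assume u: "u \<in> Hom C P W" and z: "u \<cdot> ?h = hzero C S W"
      have "u \<cdot> (k \<cdot> a) = (u \<cdot> ?h) \<cdot> i" using hi cmp_assoc[OF m(1) h u] by simp
      then have "(u \<cdot> k) \<cdot> a = hzero C Y W"
        unfolding z using cmp_assoc[OF s'(2) t'(1) u] m u by (simp add: Hom_iff)
      then have "u \<cdot> k = hzero C L W" by (rule epi_cancel_zero[OF s'(5,2) cmp_in_Hom[OF t'(1) u]])
      then obtain v where v: "v \<in> Hom C E W" "v \<cdot> e = u" by (rule ses_descend[OF t u])
      have "u \<cdot> \<sigma> = (u \<cdot> ?h) \<cdot> j" using hj cmp_assoc[OF m(2) h u] by simp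
      then have "u \<cdot> \<sigma> = hzero C E W" unfolding z using m u by (simp add: Hom_iff)
      moreover have "u \<cdot> \<sigma> = v" using v sg cmp_assoc[OF sg(1) t'(2) v(1)] by (simp add: Hom_iff)
      ultimately show "u = hzero C P W" using v t' by (auto simp: Hom_iff)
    qed
  next
    fix W w assume w: "w \<in> Hom C W S" and z: "?h \<cdot> w = hzero C W P"
    have pw: "p \<cdot> w \<in> Hom C W Y" and qw: "q \<cdot> w \<in> Hom C W E"
      using w m by (auto intro: cmp_in_Hom)
    have apw: "a \<cdot> (p \<cdot> w) \<in> Hom C W L" by (rule cmp_in_Hom[OF pw s'(2)])
    have "e \<cdot> (?h \<cdot> w) = hplus C ((e \<cdot> k) \<cdot> (a \<cdot> (p \<cdot> w))) ((e \<cdot> \<sigma>) \<cdot> (q \<cdot> w))"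
      unfolding h_eq[OF w] using apw qw t'(1,2) sg(1) by (simp add: Hom_iff)
    also have "\<dots> = q \<cdot> w"
      unfolding t'(3) sg(2) using apw qw t'(8) by (simp add: Hom_iff)
    finally have qw0: "q \<cdot> w = hzero C W E" unfolding z using t' w by (simp add: Hom_iff)
    have "k \<cdot> (a \<cdot> (p \<cdot> w)) = hzero C W P"
      using h_eq[OF w] z qw0 sg apw t' by (simp add: Hom_iff)
    then have "a \<cdot> (p \<cdot> w) = hzero C W L" by (rule mono_cancel_zero[OF t'(4,1) apw])
    then obtain c where c: "c \<in> Hom C W L'" "b \<cdot> c = p \<cdot> w" by (rule ses_lift[OF s pw])
    have "(i \<cdot> b) \<cdot> c = i \<cdot> (p \<cdot> w)" using cmp_assoc[OF c(1) s'(1) m(1)] c by simp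
    also have "\<dots> = w" using biproduct_maps_decomp[OF bp w] qw0 m pw by (simp add: Hom_iff)
    finally show "\<exists>h\<in>Hom C W L'. (i \<cdot> b) \<cdot> h = w" using c by blast
  qed
  with biproduct_ses[OF bp] show thesis by (rule that)
qed

lemma retraction_biproduct:
  assumes s: "ses C X f Y g Z" and sg: "\<sigma> \<in> Hom C Z Y" "g \<cdot> \<sigma> = idt C Z"
  shows "is_biproduct C X Z Y"
proof -
  note s' = sesD[OF s]
  have "idt C Y \<in> Hom C Y Y" "\<sigma> \<cdot> g \<in> Hom C Y Y"
    using s' sg idt_in_Hom by (auto intro: cmp_in_Hom)
  then obtain d where d: "d \<in> Hom C Y Y" "hplus C d (\<sigma> \<cdot> g) = idt C Y"
    using ex_hminus by blast
  have "hplus C (g \<cdot> d) g = g \<cdot> hplus C d (\<sigma> \<cdot> g)"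
    using s' sg d(1) cmp_assoc[OF s'(2) sg(1) s'(2)] by (simp add: Hom_iff)
  then have "hplus C (g \<cdot> d) g = g" using d s' by (simp add: Hom_iff)
  then have "g \<cdot> d = hzero C Y Z" by (rule hplus_eq_self[OF cmp_in_Hom[OF d(1) s'(2)] s'(2)])
  then obtain p where p: "p \<in> Hom C Y X" "f \<cdot> p = d" by (rule ses_lift[OF s d(1)])
  have df: "d \<cdot> f = f"
  proof -
    have "f = hplus C d (\<sigma> \<cdot> g) \<cdot> f" using d s' by (simp add: Hom_iff)
    also have "\<dots> = hplus C (d \<cdot> f) (\<sigma> \<cdot> (g \<cdot> f))" using d(1) s' sg by (simp add: Hom_iff)
    also have "\<dots> = d \<cdot> f" using d(1) s' sg by (simp add: Hom_iff)
    finally show ?thesis by simp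
  qed
  have ds: "d \<cdot> \<sigma> = hzero C Z Y"
  proof -
    have "hplus C (d \<cdot> \<sigma>) \<sigma> = hplus C d (\<sigma> \<cdot> g) \<cdot> \<sigma>" using d(1) s' sg by (simp add: Hom_iff)
    then have "hplus C (d \<cdot> \<sigma>) \<sigma> = \<sigma>" using d s' sg by (simp add: Hom_iff)
    then show ?thesis by (rule hplus_eq_self[OF cmp_in_Hom[OF sg(1) d(1)] sg(1)])
  qed
  have "f \<cdot> (p \<cdot> f) = f \<cdot> idt C X" using cmp_assoc[OF s'(1) p(1) s'(1)] p df s' by (simp add: Hom_iff)
  then have "p \<cdot> f = idt C X"
    by (rule mono_cancel[OF s'(4,1) cmp_in_Hom[OF s'(1) p(1)] idt_in_Hom[OF s'(6)]])
  moreover have "f \<cdot> (p \<cdot> \<sigma>) = hzero C Z Y" using cmp_assoc[OF sg(1) p(1) s'(1)] p ds by simp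
  then have "p \<cdot> \<sigma> = hzero C Z X" by (rule mono_cancel_zero[OF s'(4,1) cmp_in_Hom[OF sg(1) p(1)]])
  ultimately show ?thesis
    unfolding is_biproduct_def using s' sg p d by blast
qed

end

section \<open>Exactness and resolutions\<close>

primrec rdim :: "('o, 'm) cat \<Rightarrow> 'o set \<Rightarrow> nat \<Rightarrow> 'o \<Rightarrow> bool" where
  "rdim C \<X> 0 M \<longleftrightarrow> M \<in> \<X>"
| "rdim C \<X> (Suc n) M \<longleftrightarrow> (\<exists>K k Y e. Y \<in> \<X> \<and> ses C K k Y e M \<and> rdim C \<X> n K)"

context abelian_category
begin

lemma zero_object_arrows:
  assumes "zero_object C Z"
  shows "f \<in> Hom C X Z \<Longrightarrow> f = hzero C X Z" "f \<in> Hom C Z X \<Longrightarrow> f = hzero C Z X"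
proof -
  have Z: "Z \<in> Ob C" using assms by (simp add: zero_object_def)
  { assume f: "f \<in> Hom C X Z"
    have "\<exists>!f. f \<in> Hom C X Z" using assms Hom_Ob[OF f] by (simp add: zero_object_def)
    with f show "f = hzero C X Z" using hzero_in_Hom[OF Hom_Ob[OF f]] by blast }
  { assume f: "f \<in> Hom C Z X"
    have "\<exists>!f. f \<in> Hom C Z X" using assms Hom_Ob[OF f] by (simp add: zero_object_def)
    with f show "f = hzero C Z X" using hzero_in_Hom[OF Hom_Ob[OF f]] by blast }
qed

lemma idt_mono_epi:
  assumes "X \<in> Ob C" shows "is_mono C (idt C X)" "is_epi C (idt C X)"
  using split_mono[OF idt_in_Hom[OF assms] idt_in_Hom[OF assms]]
    split_epi[OF idt_in_Hom[OF assms] idt_in_Hom[OF assms]] assms by simp_all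

lemma exact_atE:
  assumes "exact_at C f g"
  obtains X I Y Z m e where "f \<in> Hom C X Y" "g \<in> Hom C Y Z" "e \<in> Hom C X I" "m \<in> Hom C I Y"
    "is_epi C e" "is_kernel C g m" "m \<cdot> e = f"
proof -
  obtain m c where *: "trg C f = src C g" "is_cokernel C f c" "is_kernel C c m" "is_kernel C g m"
    using assms unfolding exact_at_def is_image_def by blast
  have Ar: "f \<in> Ar C" "g \<in> Ar C" using *(2,4) unfolding is_cokernel_def is_kernel_def by blast+
  have f: "f \<in> Hom C (src C f) (trg C f)" and g: "g \<in> Hom C (trg C f) (trg C g)"
    using Ar *(1) by (simp_all add: Hom_def)
  have m: "m \<in> Hom C (src C m) (trg C f)" by (rule kernel_Hom[OF *(4) g])
  obtain e where e: "e \<in> Hom C (src C f) (src C m)" "is_epi C e" "m \<cdot> e = f"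
    using image_factorization[OF f *(2,3) m] .
  show thesis by (rule that[OF f g e(1) m e(2) *(4) e(3)])
qed

lemma exact_atI:
  assumes f: "f \<in> Hom C X Y" and g: "g \<in> Hom C Y Z" and e: "e \<in> Hom C X I" "is_epi C e"
    and m: "m \<in> Hom C I Y" "is_kernel C g m" and me: "m \<cdot> e = f"
  shows "exact_at C f g"
proof -
  obtain c where c: "is_cokernel C f c" using ex_cokernel f by (auto simp: Hom_def)
  obtain Q where cQ: "c \<in> Hom C Y Q" using cokernel_Hom[OF c f] by blast
  obtain R d where s: "ses C I m Y d R" using mono_ses[OF kernel_mono[OF m(2)] m(1)] .
  note s' = sesD[OF s]
  have "is_kernel C c m"
  proof (rule kernelI[OF cQ m(1) kernel_mono[OF m(2)]])
    have "(c \<cdot> m) \<cdot> e = hzero C X Q"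
      using cmp_assoc[OF e(1) m(1) cQ] me cokernel_zero[OF c f cQ] by simp
    then show "c \<cdot> m = hzero C I Q" by (rule epi_cancel_zero[OF e(2,1) cmp_in_Hom[OF m(1) cQ]])
    have "d \<cdot> f = (d \<cdot> m) \<cdot> e" using cmp_assoc[OF e(1) m(1) s'(2)] me by simp
    also have "\<dots> = hzero C X R" unfolding s'(3) using s'(8) e(1) by (simp add: Hom_iff)
    finally obtain h where h: "h \<in> Hom C Q R" "h \<cdot> c = d"
      by (rule cokernel_factor[OF c f cQ s'(2)])
    fix W w assume w: "w \<in> Hom C W Y" and z: "c \<cdot> w = hzero C W Q"
    have "d \<cdot> w = h \<cdot> (c \<cdot> w)" using cmp_assoc[OF w cQ h(1)] h(2) by simp
    also have "\<dots> = hzero C W R" unfolding z using h(1) w by (simp add: Hom_iff)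
    finally obtain x where "x \<in> Hom C W I" "m \<cdot> x = w" by (rule ses_lift[OF s w])
    then show "\<exists>h\<in>Hom C W I. m \<cdot> h = w" by blast
  qed
  then show ?thesis
    using c m(2) f g unfolding exact_at_def is_image_def by (auto simp: Hom_def)
qed

lemma exact_at_zero:
  assumes "exact_at C f g" "f \<in> Hom C X Y" "g \<in> Hom C Y Z"
  shows "g \<cdot> f = hzero C X Z"
proof -
  obtain X' I Y' Z' m e where *: "f \<in> Hom C X' Y'" "g \<in> Hom C Y' Z'" "e \<in> Hom C X' I"
    "m \<in> Hom C I Y'" "is_epi C e" "is_kernel C g m" "m \<cdot> e = f"
    using exact_atE[OF assms(1)] .
  have eq: "X' = X" "Z' = Z" using *(1,2) assms(2,3) by (auto simp: Hom_def)
  have "g \<cdot> f = (g \<cdot> m) \<cdot> e" using cmp_assoc[OF *(3,4,2)] *(7) by simp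
  also have "\<dots> = hzero C X Z"
    unfolding kernel_zero[OF *(6,2,4)] eq(2) using *(3) assms(3) eq(1) by (simp add: Hom_iff)
  finally show ?thesis .
qed

lemma exact_at_from_zero_iff:
  assumes Z: "zero_object C Z"
  shows "exact_at C (hzero C Z (src C f)) f \<longleftrightarrow> is_mono C f"
proof
  have ZO: "Z \<in> Ob C" using Z by (simp add: zero_object_def)
  {
    assume "exact_at C (hzero C Z (src C f)) f"
    then obtain X I Y Y' m e where *: "hzero C Z (src C f) \<in> Hom C X Y" "f \<in> Hom C Y Y'"
      "e \<in> Hom C X I" "m \<in> Hom C I Y" "is_epi C e" "is_kernel C f m"
      "m \<cdot> e = hzero C Z (src C f)"
      by (rule exact_atE)
    have Y: "src C f = Y" using *(2) by (simp add: Hom_def)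
    have X: "X = Z"
      using *(1) Y hzero_arrow(2)[OF ZO Hom_Ob(1)[OF *(2)]] by (simp add: Hom_def)
    have m0: "m = hzero C I Y"
      by (rule epi_cancel_zero[OF *(5,3,4)]) (use *(7) X Y in simp)
    show "is_mono C f"
    proof (rule monoI[OF *(2)])
      fix W w assume w: "w \<in> Hom C W Y" and z: "f \<cdot> w = hzero C W Y'"
      obtain h where h: "h \<in> Hom C W I" "m \<cdot> h = w" using kernel_factor[OF *(6,2,4) w z] .
      show "w = hzero C W Y"
        unfolding h(2)[symmetric] m0 using h(1) w by (simp add: Hom_iff)
    qed
  }
  assume mono: "is_mono C f"
  then obtain X Y where f: "f \<in> Hom C X Y" using ArE unfolding is_mono_def by blast
  note Ob = Hom_Ob[OF f]
  have sf: "src C f = X" using f by (simp add: Hom_def)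
  have zX: "hzero C Z X \<in> Hom C Z X" by (rule hzero_in_Hom[OF ZO Ob(1)])
  have "is_kernel C f (hzero C Z X)"
  proof (rule kernelI[OF f zX])
    show "is_mono C (hzero C Z X)"
      by (rule monoI[OF zX]) (rule zero_object_arrows(1)[OF Z])
    show "f \<cdot> hzero C Z X = hzero C Z Y" using f ZO by (simp add: Hom_iff)
    fix W w assume w: "w \<in> Hom C W X" and "f \<cdot> w = hzero C W Y"
    then have "w = hzero C W X" using mono_cancel_zero[OF mono f] by blast
    then have "hzero C Z X \<cdot> hzero C W Z = w" using w ZO by (simp add: Hom_iff)
    then show "\<exists>h\<in>Hom C W Z. hzero C Z X \<cdot> h = w"
      using hzero_in_Hom[OF Hom_Ob(1)[OF w] ZO] by blast
  qed
  then show "exact_at C (hzero C Z (src C f)) f"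
    unfolding sf
    by (intro exact_atI[OF zX f idt_in_Hom[OF ZO] idt_mono_epi(2)[OF ZO] zX])
      (use ZO Ob in simp_all)
qed

lemma exact_at_to_zero_iff:
  assumes Z: "zero_object C Z"
  shows "exact_at C g (hzero C (trg C g) Z) \<longleftrightarrow> is_epi C g"
proof
  have ZO: "Z \<in> Ob C" using Z by (simp add: zero_object_def)
  {
    assume "exact_at C g (hzero C (trg C g) Z)"
    then obtain X I Y Y' m e where *: "g \<in> Hom C X Y" "hzero C (trg C g) Z \<in> Hom C Y Y'"
      "e \<in> Hom C X I" "m \<in> Hom C I Y" "is_epi C e" "is_kernel C (hzero C (trg C g) Z) m"
      "m \<cdot> e = g"
      by (rule exact_atE)
    have Y: "trg C g = Y" using *(1) by (simp add: Hom_def)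
    note YO = Hom_Ob(2)[OF *(1)]
    have "Y' = Z" using *(2) Y hzero_arrow(3)[OF YO ZO] by (simp add: Hom_def)
    then have "hzero C (trg C g) Z \<cdot> idt C Y = hzero C Y Y'" using YO ZO Y by simp
    then obtain h where h: "h \<in> Hom C Y I" "m \<cdot> h = idt C Y"
      by (rule kernel_factor[OF *(6,2,4) idt_in_Hom[OF YO]])
    show "is_epi C g"
      unfolding *(7)[symmetric] by (rule epi_comp[OF *(5) split_epi[OF *(4) h] *(3,4)])
  }
  assume epi: "is_epi C g"
  then obtain X Y where g: "g \<in> Hom C X Y" using ArE unfolding is_epi_def by blast
  note Ob = Hom_Ob[OF g]
  have tg: "trg C g = Y" using g by (simp add: Hom_def)
  have z: "hzero C Y Z \<in> Hom C Y Z" by (rule hzero_in_Hom[OF Ob(2) ZO])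
  have "is_kernel C (hzero C Y Z) (idt C Y)"
  proof (rule kernelI[OF z idt_in_Hom[OF Ob(2)] idt_mono_epi(1)[OF Ob(2)]])
    show "hzero C Y Z \<cdot> idt C Y = hzero C Y Z" using Ob ZO by simp
    fix W w assume "w \<in> Hom C W Y"
    then show "\<exists>h\<in>Hom C W Y. idt C Y \<cdot> h = w" using cmp_idt_left by blast
  qed
  then show "exact_at C g (hzero C (trg C g) Z)"
    unfolding tg by (rule exact_atI[OF g z g epi idt_in_Hom[OF Ob(2)] _ cmp_idt_left[OF g]])
qed

lemma short_exact_iff: "short_exact C f g \<longleftrightarrow> (\<exists>X Y Z. ses C X f Y g Z)"
proof
  assume "short_exact C f g"
  then have mono: "is_mono C f" and epi: "is_epi C g" and ex: "exact_at C f g"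
    using exact_at_from_zero_iff exact_at_to_zero_iff unfolding short_exact_def by blast+
  from ex obtain X I Y Z m e where *: "f \<in> Hom C X Y" "g \<in> Hom C Y Z" "e \<in> Hom C X I"
    "m \<in> Hom C I Y" "is_epi C e" "is_kernel C g m" "m \<cdot> e = f"
    by (rule exact_atE)
  have mono_e: "is_mono C e" by (rule mono_right_factor[OF _ *(3,4)]) (simp add: *(7) mono)
  obtain e' where e': "e' \<in> Hom C I X" "e \<cdot> e' = idt C I"
    using mono_epi_inverse[OF mono_e *(5,3)] by blast
  have "f \<cdot> e' = m \<cdot> idt C I" using cmp_assoc[OF e'(1) *(3,4)] *(7) e'(2) by simp
  then have fe: "f \<cdot> e' = m" using *(4) by (simp add: Hom_iff)
  have "ses C X f Y g Z"
  proof (rule sesI[OF *(1,2) mono epi exact_at_zero[OF ex *(1,2)]])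
    fix W w assume w: "w \<in> Hom C W Y" and z: "g \<cdot> w = hzero C W Z"
    obtain h where h: "h \<in> Hom C W I" "m \<cdot> h = w" using kernel_factor[OF *(6,2,4) w z] .
    have "f \<cdot> (e' \<cdot> h) = w" using cmp_assoc[OF h(1) e'(1) *(1)] fe h(2) by simp
    then show "\<exists>h\<in>Hom C W X. f \<cdot> h = w" using cmp_in_Hom[OF h(1) e'(1)] by blast
  qed
  then show "\<exists>X Y Z. ses C X f Y g Z" by blast
next
  assume "\<exists>X Y Z. ses C X f Y g Z"
  then obtain X Y Z where s: "ses C X f Y g Z" by blast
  note s' = sesD[OF s]
  have "exact_at C f g"
    by (rule exact_atI[OF s'(1,2) idt_in_Hom[OF s'(6)] idt_mono_epi(2)[OF s'(6)] s'(1) _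
          cmp_idt_right[OF s'(1)]]) (use s in \<open>simp add: ses_def\<close>)
  moreover obtain O' where "zero_object C O'" using ex_zero_object by blast
  ultimately show "short_exact C f g"
    using s'(4,5) exact_at_from_zero_iff exact_at_to_zero_iff unfolding short_exact_def by blast
qed

lemma exact_at_mono_comp:
  assumes m: "is_mono C m" "m \<in> Hom C I Y" and e: "e \<in> Hom C X I"
  shows "exact_at C x (m \<cdot> e) \<longleftrightarrow> exact_at C x e"
proof -
  have me: "m \<cdot> e \<in> Hom C X Y" by (rule cmp_in_Hom[OF e m(2)])
  have zero: "(m \<cdot> e) \<cdot> w = hzero C W Y \<longleftrightarrow> e \<cdot> w = hzero C W I" if w: "w \<in> Hom C W X" for w W
  proof
    assume "(m \<cdot> e) \<cdot> w = hzero C W Y"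
    then have "m \<cdot> (e \<cdot> w) = hzero C W Y" using cmp_assoc[OF w e m(2)] by simp
    then show "e \<cdot> w = hzero C W I" by (rule mono_cancel_zero[OF m cmp_in_Hom[OF w e]])
  next
    assume "e \<cdot> w = hzero C W I"
    then show "(m \<cdot> e) \<cdot> w = hzero C W Y"
      using cmp_assoc[OF w e m(2)] m(2) w by (simp add: Hom_iff)
  qed
  have ker: "is_kernel C (m \<cdot> e) k \<longleftrightarrow> is_kernel C e k" for k
  proof
    assume k: "is_kernel C (m \<cdot> e) k"
    note kX = kernel_Hom[OF k me]
    show "is_kernel C e k"
      by (rule kernelI[OF e kX kernel_mono[OF k]])
        (use zero kX kernel_zero[OF k me kX] kernel_factor[OF k me kX] in \<open>blast+\<close>)
  next
    assume k: "is_kernel C e k"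
    note kX = kernel_Hom[OF k e]
    show "is_kernel C (m \<cdot> e) k"
      by (rule kernelI[OF me kX kernel_mono[OF k]])
        (use zero kX kernel_zero[OF k e kX] kernel_factor[OF k e kX] in \<open>blast+\<close>)
  qed
  have "src C (m \<cdot> e) = src C e" using me e by (simp add: Hom_def)
  then show ?thesis unfolding exact_at_def ker by simp
qed

lemma has_resolution_iff_mono_epi:
  "has_resolution C \<X> n M \<longleftrightarrow>
     (\<exists>d. (\<forall>i\<le>n. src C (d i) \<in> \<X>) \<and> trg C (d 0) = M \<and> is_mono C (d n) \<and>
       (\<forall>i<n. exact_at C (d (Suc i)) (d i)) \<and> is_epi C (d 0))"
proof
  assume "has_resolution C \<X> n M"
  then show "\<exists>d. (\<forall>i\<le>n. src C (d i) \<in> \<X>) \<and> trg C (d 0) = M \<and> is_mono C (d n) \<and>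
      (\<forall>i<n. exact_at C (d (Suc i)) (d i)) \<and> is_epi C (d 0)"
    unfolding has_resolution_def using exact_at_from_zero_iff exact_at_to_zero_iff by blast
next
  obtain Z where "zero_object C Z" using ex_zero_object by blast
  moreover assume "\<exists>d. (\<forall>i\<le>n. src C (d i) \<in> \<X>) \<and> trg C (d 0) = M \<and> is_mono C (d n) \<and>
      (\<forall>i<n. exact_at C (d (Suc i)) (d i)) \<and> is_epi C (d 0)"
  ultimately show "has_resolution C \<X> n M"
    unfolding has_resolution_def using exact_at_from_zero_iff exact_at_to_zero_iff by blast
qed

lemma has_resolution_Suc_dest:
  assumes "has_resolution C \<X> (Suc n) M"
  obtains K k Y e where "Y \<in> \<X>" "ses C K k Y e M" "has_resolution C \<X> n K"
proof -
  obtain d where d: "\<And>i. i \<le> Suc n \<Longrightarrow> src C (d i) \<in> \<X>" "trg C (d 0) = M"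
    "is_mono C (d (Suc n))" "\<And>i. i < Suc n \<Longrightarrow> exact_at C (d (Suc i)) (d i)" "is_epi C (d 0)"
    using assms unfolding has_resolution_iff_mono_epi by blast
  have "exact_at C (d (Suc 0)) (d 0)" using d(4)[of 0] by simp
  then obtain X I Y Z m e where *: "d (Suc 0) \<in> Hom C X Y" "d 0 \<in> Hom C Y Z"
    "e \<in> Hom C X I" "m \<in> Hom C I Y" "is_epi C e" "is_kernel C (d 0) m" "m \<cdot> e = d (Suc 0)"
    by (rule exact_atE)
  have Z: "Z = M" using *(2) d(2) by (simp add: Hom_def)
  have src: "src C (d (Suc 0)) = X" "src C (d 0) = Y" "src C e = X" "trg C e = I"
    using *(1-3) by (simp_all add: Hom_def)
  have s: "ses C I m Y (d 0) M" using epi_kernel_ses[OF d(5) *(2,6,4)] unfolding Z .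
  define d' where "d' = (\<lambda>i. if i = 0 then e else d (Suc i))"
  have "has_resolution C \<X> n I"
    unfolding has_resolution_iff_mono_epi
  proof (intro exI[of _ d'] conjI allI impI)
    show "src C (d' i) \<in> \<X>" if "i \<le> n" for i
      using d(1)[of "Suc i"] that src by (cases i) (simp_all add: d'_def)
    show "trg C (d' 0) = I" "is_epi C (d' 0)" using src *(5) by (simp_all add: d'_def)
    show "is_mono C (d' n)"
    proof (cases n)
      case 0
      then have "is_mono C (m \<cdot> e)" using d(3) *(7) by simp
      then show ?thesis using mono_right_factor[OF _ *(3,4)] 0 by (simp add: d'_def)
    qed (use d(3) in \<open>simp add: d'_def\<close>)
    show "exact_at C (d' (Suc i)) (d' i)" if "i < n" for i
      using d(4)[of "Suc i"] that
        exact_at_mono_comp[OF kernel_mono[OF *(6)] *(4,3), unfolded *(7), of "d (Suc (Suc 0))"]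
      by (cases i) (simp_all add: d'_def)
  qed
  moreover have "Y \<in> \<X>" using d(1)[of 0] src(2) by simp
  ultimately show thesis using s that by blast
qed

lemma has_resolution_SucI:
  assumes Y: "Y \<in> \<X>" and s: "ses C K k Y e M" and "has_resolution C \<X> n K"
  shows "has_resolution C \<X> (Suc n) M"
proof -
  obtain d where d: "\<And>i. i \<le> n \<Longrightarrow> src C (d i) \<in> \<X>" "trg C (d 0) = K"
    "is_mono C (d n)" "\<And>i. i < n \<Longrightarrow> exact_at C (d (Suc i)) (d i)" "is_epi C (d 0)"
    using assms(3) unfolding has_resolution_iff_mono_epi by blast
  note s' = sesD[OF s]
  have ker: "is_kernel C e k" using s by (simp add: ses_def)
  define X where "X = src C (d 0)"
  have d0: "d 0 \<in> Hom C X K" using d(2,5) by (simp add: X_def Hom_def is_epi_def)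
  have kd: "k \<cdot> d 0 \<in> Hom C X Y" by (rule cmp_in_Hom[OF d0 s'(1)])
  have src: "src C e = Y" "trg C e = M" "src C (k \<cdot> d 0) = X"
    using kd s'(2) by (simp_all add: Hom_def)
  define d' where "d' = (\<lambda>i. if i = 0 then e else if i = 1 then k \<cdot> d 0 else d (i - 1))"
  show "has_resolution C \<X> (Suc n) M"
    unfolding has_resolution_iff_mono_epi
  proof (intro exI[of _ d'] conjI allI impI)
    show "src C (d' i) \<in> \<X>" if "i \<le> Suc n" for i
      using d(1)[of "i - 1"] that src Y by (auto simp: d'_def X_def)
    show "trg C (d' 0) = M" "is_epi C (d' 0)" using src s'(5) by (simp_all add: d'_def)
    show "is_mono C (d' (Suc n))"
      using d(3) mono_comp[OF _ s'(4) d0 s'(1)] by (cases n) (simp_all add: d'_def)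
    show "exact_at C (d' (Suc i)) (d' i)" if "i < Suc n" for i
    proof (cases i)
      case 0
      then show ?thesis using exact_atI[OF kd s'(2) d0 d(5) s'(1) ker] by (simp add: d'_def)
    next
      case (Suc j)
      then show ?thesis
        using d(4)[of j] that exact_at_mono_comp[OF s'(4,1) d0, of "d (Suc 0)"]
        by (cases j) (simp_all add: d'_def)
    qed
  qed
qed

lemma has_resolution_iff_rdim:
  assumes sub: "subcategory C \<X>"
  shows "has_resolution C \<X> n M \<longleftrightarrow> rdim C \<X> n M"
proof (induction n arbitrary: M)
  case 0
  show ?case
  proof
    assume "has_resolution C \<X> 0 M"
    then obtain d where "src C d \<in> \<X>" "trg C d = M" "is_mono C d" "is_epi C d"
      unfolding has_resolution_iff_mono_epi by auto
    moreover have "\<forall>f. is_iso C f \<and> src C f \<in> \<X> \<longrightarrow> trg C f \<in> \<X>"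
      using sub unfolding subcategory_def by (elim conjE)
    ultimately show "rdim C \<X> 0 M" using is_isoI by auto
  next
    assume "rdim C \<X> 0 M"
    then have M: "M \<in> \<X>" by simp
    then have MO: "M \<in> Ob C" using sub unfolding subcategory_def by blast
    show "has_resolution C \<X> 0 M"
      unfolding has_resolution_iff_mono_epi
      by (rule exI[of _ "\<lambda>_. idt C M"]) (use M MO idt_mono_epi[OF MO] in simp)
  qed
next
  case (Suc n)
  show ?case
  proof
    assume "has_resolution C \<X> (Suc n) M"
    then obtain K k Y e where "Y \<in> \<X>" "ses C K k Y e M" "has_resolution C \<X> n K"
      by (rule has_resolution_Suc_dest)
    then show "rdim C \<X> (Suc n) M" unfolding rdim.simps Suc.IH[symmetric] by blast
  next
    assume "rdim C \<X> (Suc n) M"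
    then show "has_resolution C \<X> (Suc n) M"
      unfolding rdim.simps Suc.IH[symmetric] using has_resolution_SucI by blast
  qed
qed

lemma rdim_mono_class: "\<X> \<subseteq> \<Y> \<Longrightarrow> rdim C \<X> n M \<Longrightarrow> rdim C \<Y> n M"
proof (induction n arbitrary: M)
  case (Suc n)
  then show ?case unfolding rdim.simps by blast
qed auto

lemma rdim_of_mem:
  assumes sub: "subcategory C \<X>" and M: "M \<in> \<X>"
  shows "rdim C \<X> n M"
proof -
  obtain Z where Z: "Z \<in> \<X>" "zero_object C Z" using sub unfolding subcategory_def by blast
  have s: "ses C Z (hzero C Z N) N (idt C N) N" if N: "N \<in> \<X>" for N
  proof -
    have Ob: "N \<in> Ob C" "Z \<in> Ob C" using N Z(1) sub unfolding subcategory_def by blast+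
    have z: "hzero C Z N \<in> Hom C Z N" by (rule hzero_in_Hom[OF Ob(2,1)])
    show ?thesis
    proof (rule sesI[OF z idt_in_Hom[OF Ob(1)] _ idt_mono_epi(2)[OF Ob(1)]])
      show "is_mono C (hzero C Z N)"
        by (rule monoI[OF z]) (rule zero_object_arrows(1)[OF Z(2)])
      show "idt C N \<cdot> hzero C Z N = hzero C Z N" using Ob by simp
      fix W w assume w: "w \<in> Hom C W N" and "idt C N \<cdot> w = hzero C W N"
      then have "hzero C Z N \<cdot> hzero C W Z = w" using cmp_idt_left[OF w] w Ob by (simp add: Hom_iff)
      then show "\<exists>h\<in>Hom C W Z. hzero C Z N \<cdot> h = w"
        using hzero_in_Hom[OF Hom_Ob(1)[OF w] Ob(2)] by blast
    qed
  qed
  have "\<And>M. M \<in> \<X> \<Longrightarrow> rdim C \<X> n M"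
  proof (induction n)
    case (Suc n)
    then show ?case unfolding rdim.simps using s Z(1) by blast
  qed simp
  then show ?thesis using M .
qed

lemma pd_le: "has_resolution C \<X> n M \<Longrightarrow> pd C \<X> M \<le> enat n"
  unfolding pd_def by (rule Inf_lower) blast

lemma pd_attained:
  assumes "pd C \<X> M < \<infinity>"
  obtains n where "pd C \<X> M = enat n" "has_resolution C \<X> n M"
proof -
  let ?S = "{enat n | n. has_resolution C \<X> n M}"
  have "?S \<noteq> {}"
  proof
    assume "?S = {}"
    then have "pd C \<X> M = \<infinity>" unfolding pd_def Inf_enat_def by simp
    with assms show False by simp
  qed
  then have "Inf ?S \<in> ?S" unfolding Inf_enat_def using LeastI_ex[of "\<lambda>x. x \<in> ?S"] by auto
  then show thesis using that unfolding pd_def by blast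
qed

end

section \<open>Vanishing of the first Ext group\<close>

context abelian_category
begin

lemma ex_projective_resolution:
  assumes enough: "enough_projectives C" and M: "M \<in> Ob C"
  shows "\<exists>d. projective_resolution C M d"
proof -
  let ?P = "\<lambda>n d. d \<in> Ar C \<and> projective C (src C d) \<and> (n = (0::nat) \<longrightarrow> trg C d = M \<and> is_epi C d)"
  have "\<exists>f. \<forall>n. ?P n (f n) \<and> exact_at C (f (Suc n)) (f n)"
  proof (rule dependent_nat_choice)
    obtain e where "is_epi C e" "trg C e = M" "projective C (src C e)"
      using enough M unfolding enough_projectives_def by blast
    then show "\<exists>d. ?P 0 d" by (auto simp: is_epi_def)
  next
    fix d n assume "?P n d"
    then obtain X Y where d: "d \<in> Hom C X Y" using ArE by blast
    obtain m where m: "is_kernel C d m" using ex_kernel d by (auto simp: Hom_def)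
    obtain I where mI: "m \<in> Hom C I X" using kernel_Hom[OF m d] by blast
    obtain e where e: "is_epi C e" "trg C e = I" "projective C (src C e)"
      using enough Hom_Ob(1)[OF mI] unfolding enough_projectives_def by blast
    have eH: "e \<in> Hom C (src C e) I" using e by (simp add: Hom_def is_epi_def)
    have me: "m \<cdot> e \<in> Hom C (src C e) X" by (rule cmp_in_Hom[OF eH mI])
    have "exact_at C (m \<cdot> e) d" by (rule exact_atI[OF me d eH e(1) mI m refl])
    then show "\<exists>d'. ?P (Suc n) d' \<and> exact_at C d' d"
      by (intro exI[of _ "m \<cdot> e"]) (use me e(3) in \<open>simp add: Hom_def\<close>)
  qed
  then obtain d where d: "\<And>n. ?P n (d n)" "\<And>n. exact_at C (d (Suc n)) (d n)" by blast
  obtain Z where Z: "zero_object C Z" using ex_zero_object by blast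
  have "trg C (d 0) = M" "is_epi C (d 0)" using d(1)[of 0] by simp_all
  then have "exact_at C (d 0) (hzero C M Z)" using exact_at_to_zero_iff[OF Z, of "d 0"] by simp
  then show ?thesis
    using d Z \<open>trg C (d 0) = M\<close> unfolding projective_resolution_def by blast
qed

lemma trivial_Ext1_factor:
  assumes d: "d = (SOME d. projective_resolution C K d)"
    and hom: "d (Suc 0) \<in> Hom C P1 P0" and X: "X \<in> Ob C"
    and triv: "trivial_group (Ext C 1 K X)"
    and v: "v \<in> Hom C P1 X" "v \<cdot> d (Suc (Suc 0)) = hzero C (src C (d (Suc (Suc 0)))) X"
    and P0: "src C (d 0) = P0"
  obtains w where "w \<in> Hom C P0 X" "w \<cdot> d (Suc 0) = v"
proof -
  let ?G = "(Hom_group C (src C (d 1)) X)\<lparr>carrier := Ext_cocycles C d X 1\<rparr>"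
  let ?B = "Ext_coboundaries C d X 1"
  have src: "src C (d (Suc 0)) = P1" using hom by (simp add: Hom_def)
  have B: "?B = (\<lambda>g. g \<cdot> d (Suc 0)) ` Hom C P0 X"
    by (simp add: Ext_coboundaries_def P0)
  have "carrier (Ext C 1 K X) = {\<one>\<^bsub>Ext C 1 K X\<^esub>}" using triv by (simp add: trivial_group_def)
  then have cos: "rcosets\<^bsub>?G\<^esub> ?B = {?B}"
    unfolding Ext_def Let_def d[symmetric] FactGroup_def by simp
  have "v \<in> carrier ?G" using v src by (simp add: Ext_cocycles_def)
  then have "?B #>\<^bsub>?G\<^esub> v \<in> rcosets\<^bsub>?G\<^esub> ?B" unfolding RCOSETS_def by blast
  then have eq: "?B #>\<^bsub>?G\<^esub> v = ?B" using cos by blast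
  have z: "hzero C P1 X \<in> ?B"
    unfolding B
  proof (rule image_eqI)
    show "hzero C P0 X \<in> Hom C P0 X" using hzero_in_Hom[OF Hom_Ob(2)[OF hom] X] .
    show "hzero C P1 X = hzero C P0 X \<cdot> d (Suc 0)" using hom X by (simp add: Hom_iff)
  qed
  have "hplus C (hzero C P1 X) v \<in> ?B #>\<^bsub>?G\<^esub> v"
    unfolding r_coset_def using z by (auto simp: Hom_group_def)
  moreover have "hplus C (hzero C P1 X) v = v" using v(1) by (simp add: Hom_iff)
  ultimately have "v \<in> ?B" using eq by simp
  then show thesis unfolding B using that by blast
qed

lemma Ext1_trivial_splits:
  assumes enough: "enough_projectives C" and s: "ses C X f Y g K"
    and triv: "trivial_group (Ext C 1 K X)"
  obtains \<sigma> where "\<sigma> \<in> Hom C K Y" "g \<cdot> \<sigma> = idt C K"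
proof -
  note s' = sesD[OF s]
  define d where "d = (SOME d. projective_resolution C K d)"
  have res: "projective_resolution C K d"
    unfolding d_def using ex_projective_resolution[OF enough s'(8)] by (rule someI_ex)
  define P where "P n = src C (d n)" for n
  have proj: "projective C (P n)" and ex: "exact_at C (d (Suc n)) (d n)" for n
    using res unfolding projective_resolution_def P_def by blast+
  have tK: "trg C (d 0) = K" using res unfolding projective_resolution_def by blast
  obtain Z where "zero_object C Z" "exact_at C (d 0) (hzero C K Z)"
    using res unfolding projective_resolution_def by blast
  then have epi0: "is_epi C (d 0)" using exact_at_to_zero_iff[of Z "d 0"] tK by simp
  then have d0: "d 0 \<in> Hom C (P 0) K" using tK by (simp add: Hom_def is_epi_def P_def)
  have dS: "d (Suc n) \<in> Hom C (P (Suc n)) (P n)" for n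
    using ex[of n] by (auto elim!: exact_atE simp: Hom_def P_def)
  have dd0: "d 0 \<cdot> d (Suc 0) = hzero C (P (Suc 0)) K" by (rule exact_at_zero[OF ex dS d0])
  have ddS: "d (Suc 0) \<cdot> d (Suc (Suc 0)) = hzero C (P (Suc (Suc 0))) (P 0)"
    by (rule exact_at_zero[OF ex dS dS])
  obtain u where u: "u \<in> Hom C (P 0) Y" "g \<cdot> u = d 0"
    using projective_lift[OF proj s'(5,2) d0] .
  have ud: "u \<cdot> d (Suc 0) \<in> Hom C (P (Suc 0)) Y" by (rule cmp_in_Hom[OF dS u(1)])
  have "g \<cdot> (u \<cdot> d (Suc 0)) = hzero C (P (Suc 0)) K"
    using cmp_assoc[OF dS u(1) s'(2)] u(2) dd0 by simp
  then obtain v where v: "v \<in> Hom C (P (Suc 0)) X" "f \<cdot> v = u \<cdot> d (Suc 0)"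
    by (rule ses_lift[OF s ud])
  have "f \<cdot> (v \<cdot> d (Suc (Suc 0))) = u \<cdot> (d (Suc 0) \<cdot> d (Suc (Suc 0)))"
    using cmp_assoc[OF dS v(1) s'(1)] cmp_assoc[OF dS dS u(1)] v(2) by simp
  also have "\<dots> = hzero C (P (Suc (Suc 0))) Y"
    unfolding ddS using u(1) Hom_Ob(1)[OF dS] by (simp add: Hom_iff)
  finally have "v \<cdot> d (Suc (Suc 0)) = hzero C (P (Suc (Suc 0))) X"
    by (rule mono_cancel_zero[OF s'(4,1) cmp_in_Hom[OF dS v(1)]])
  then have vz: "v \<cdot> d (Suc (Suc 0)) = hzero C (src C (d (Suc (Suc 0)))) X"
    by (simp add: P_def)
  obtain w where w: "w \<in> Hom C (P 0) X" "w \<cdot> d (Suc 0) = v"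
    using trivial_Ext1_factor[OF d_def dS s'(6) triv v(1) vz P_def[symmetric]] .
  have fw: "f \<cdot> w \<in> Hom C (P 0) Y" by (rule cmp_in_Hom[OF w(1) s'(1)])
  obtain t where t: "t \<in> Hom C (P 0) Y" "hplus C t (f \<cdot> w) = u" using ex_hminus[OF u(1) fw] .
  have td: "t \<cdot> d (Suc 0) = hzero C (P (Suc 0)) Y"
  proof (rule hplus_eq_self[OF cmp_in_Hom[OF dS t(1)] ud])
    have "hplus C (t \<cdot> d (Suc 0)) ((f \<cdot> w) \<cdot> d (Suc 0)) = u \<cdot> d (Suc 0)"
      using cmp_hplus_left[OF dS t(1) fw] t(2) by simp
    then show "hplus C (t \<cdot> d (Suc 0)) (u \<cdot> d (Suc 0)) = u \<cdot> d (Suc 0)"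
      using cmp_assoc[OF dS w(1) s'(1)] w(2) v(2) by simp
  qed
  obtain P' I P0' K' m e where *: "d (Suc 0) \<in> Hom C P' P0'" "d 0 \<in> Hom C P0' K'"
    "e \<in> Hom C P' I" "m \<in> Hom C I P0'" "is_epi C e" "is_kernel C (d 0) m" "m \<cdot> e = d (Suc 0)"
    using exact_atE[OF ex[of 0]] .
  have eqs: "P0' = P 0" "K' = K" "P' = P (Suc 0)" using *(1,2) d0 dS[of 0] by (auto simp: Hom_def)
  have m: "m \<in> Hom C I (P 0)" and e: "e \<in> Hom C (P (Suc 0)) I" using *(3,4) eqs by simp_all
  have s0: "ses C I m (P 0) (d 0) K" by (rule epi_kernel_ses[OF epi0 d0 *(6) m])
  have "(t \<cdot> m) \<cdot> e = hzero C (P (Suc 0)) Y" using cmp_assoc[OF e m t(1)] *(7) td by simp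
  then have "t \<cdot> m = hzero C I Y" by (rule epi_cancel_zero[OF *(5) e cmp_in_Hom[OF m t(1)]])
  then obtain \<sigma> where sg: "\<sigma> \<in> Hom C K Y" "\<sigma> \<cdot> d 0 = t" by (rule ses_descend[OF s0 t(1)])
  have "g \<cdot> (f \<cdot> w) = hzero C (P 0) K"
    using cmp_assoc[OF w(1) s'(1,2)] s'(3,8) w(1) by (simp add: Hom_iff)
  moreover have "hplus C (g \<cdot> t) (g \<cdot> (f \<cdot> w)) = d 0"
    using cmp_hplus_right[OF t(1) fw s'(2)] t(2) u(2) by simp
  ultimately have gt: "g \<cdot> t = d 0" using cmp_in_Hom[OF t(1) s'(2)] by (simp add: Hom_iff)
  have "(g \<cdot> \<sigma>) \<cdot> d 0 = idt C K \<cdot> d 0"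
    using cmp_assoc[OF d0 sg(1) s'(2)] sg(2) gt cmp_idt_left[OF d0] by simp
  then have "g \<cdot> \<sigma> = idt C K"
    by (rule epi_cancel[OF epi0 d0 cmp_in_Hom[OF sg(1) s'(2)] idt_in_Hom[OF s'(8)]])
  with sg(1) show thesis by (rule that)
qed

section \<open>Resolution dimension relative to a resolving subcategory\<close>

lemma resolving_extension:
  assumes "resolving C \<T>" "ses C X f Y g Z" "X \<in> \<T>" "Z \<in> \<T>"
  shows "Y \<in> \<T>"
proof -
  have "short_exact C f g" using assms(2) short_exact_iff by blast
  moreover have "src C f = X" "trg C f = Y" "trg C g = Z"
    using sesD(1,2)[OF assms(2)] by (simp_all add: Hom_def)
  ultimately show ?thesis using assms(1,3,4) unfolding resolving_def by blast
qed

lemma resolving_kernel: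
  assumes "resolving C \<T>" "ses C X f Y g Z" "Y \<in> \<T>" "Z \<in> \<T>"
  shows "X \<in> \<T>"
proof -
  have "short_exact C f g" using assms(2) short_exact_iff by blast
  moreover have "src C f = X" "trg C f = Y" "trg C g = Z"
    using sesD(1,2)[OF assms(2)] by (simp_all add: Hom_def)
  ultimately show ?thesis using assms(1,3,4) unfolding resolving_def by blast
qed

lemma rdim_kernel:
  assumes res: "resolving C \<T>" and s: "ses C K k P b Y" and Y: "Y \<in> \<T>" and P: "rdim C \<T> n P"
  shows "rdim C \<T> n K"
proof (cases n)
  case 0
  then show ?thesis using resolving_kernel[OF res s _ Y] P by simp
next
  case (Suc m)
  then obtain L l X a where X: "X \<in> \<T>" and t: "ses C L l X a P" and L: "rdim C \<T> m L"
    using P by auto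
  obtain N i l' r where u: "ses C N i X (b \<cdot> a) Y" and v: "ses C L l' N r K"
    using epi_comp_ses[OF t s] .
  have "N \<in> \<T>" by (rule resolving_kernel[OF res u X Y])
  then show ?thesis unfolding Suc rdim.simps using v L by blast
qed

text \<open>A cover of \<open>P\<close> requires a lift of \<open>g\<close>: pulling back along a projective object \<open>E\<close> mapping onto \<open>X\<close>
  makes the extension split.\<close>

lemma rdim_extension:
  assumes res: "resolving C \<T>" and enough: "enough_projectives C"
  shows "ses C L k P g X \<Longrightarrow> X \<in> \<T> \<Longrightarrow> rdim C \<T> n L \<Longrightarrow> rdim C \<T> n P"
proof (induction n arbitrary: L k P g X)
  case 0
  then show ?case using resolving_extension[OF res] by simp
next
  case (Suc n)
  obtain L' l Y a where Y: "Y \<in> \<T>" and t: "ses C L' l Y a L" and L': "rdim C \<T> n L'"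
    using Suc.prems(3) by auto
  note XO = sesD(8)[OF Suc.prems(1)]
  obtain e where e: "is_epi C e" "trg C e = X" "projective C (src C e)"
    using enough XO unfolding enough_projectives_def by blast
  define E where "E = src C e"
  have E: "projective C E" using e(3) by (simp add: E_def)
  have ET: "E \<in> \<T>" using res E unfolding resolving_def by blast
  have eH: "e \<in> Hom C E X" using e by (simp add: Hom_def is_epi_def E_def)
  obtain \<Omega> w where o: "ses C \<Omega> w E e X" using epi_ses[OF e(1) eH] .
  have Om: "\<Omega> \<in> \<T>" by (rule resolving_kernel[OF res o ET Suc.prems(2)])
  obtain P' k' b w' c where p1: "ses C L k' P' b E" and p2: "ses C \<Omega> w' P' c P"
    using pullback_ses[OF Suc.prems(1) o] .
  obtain S i q b' h where S: "ses C Y i S q E" and h: "ses C L' b' S h P'"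
    using horseshoe_step[OF t p1 E] .
  have ST: "S \<in> \<T>" by (rule resolving_extension[OF res S Y ET])
  obtain N n' r s' where N: "ses C N n' S (c \<cdot> h) P" and r: "ses C L' r N s' \<Omega>"
    using epi_comp_ses[OF h p2] .
  have "rdim C \<T> n N" by (rule Suc.IH[OF r Om L'])
  then show ?case unfolding rdim.simps using N ST by blast
qed

lemma rdim_syzygy:
  assumes res: "resolving C \<T>" and enough: "enough_projectives C"
    and s: "ses C K k X e M" and X: "X \<in> \<T>" and M: "rdim C \<T> (Suc n) M"
  shows "rdim C \<T> n K"
proof -
  obtain L l Y a where Y: "Y \<in> \<T>" and t: "ses C L l Y a M" and L: "rdim C \<T> n L"
    using M by auto
  obtain P k' b l' c where p: "ses C K k' P b Y" "ses C L l' P c X" using pullback_ses[OF s t] .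
  show ?thesis
    by (rule rdim_kernel[OF res p(1) Y rdim_extension[OF res enough p(2) X L]])
qed

lemma coproper_cogeneratorE:
  assumes "coproper_cogenerator C \<E> \<C> \<T>" "T \<in> \<T>"
  obtains f G g T' where "ses C T f G g T'" "G \<in> \<C>" "T' \<in> \<T>"
proof -
  obtain f g where fg: "short_exact C f g" "src C f = T" "trg C f \<in> \<C>" "trg C g \<in> \<T>"
    using assms unfolding coproper_cogenerator_def by blast
  obtain X Y Z where s: "ses C X f Y g Z" using fg(1) short_exact_iff by blast
  have eq: "X = T" "trg C f = Y" "trg C g = Z" using sesD(1,2)[OF s] fg(2) by (auto simp: Hom_def)
  show thesis by (rule that[of f Y g Z]) (use s fg(3,4) in \<open>simp_all add: eq\<close>)
qed

lemma cogenerator_approximation: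
  assumes res: "resolving C \<T>" and cog: "coproper_cogenerator C \<E> \<C> \<T>"
  shows "rdim C \<T> n M \<Longrightarrow> \<exists>f Y g T. ses C M f Y g T \<and> T \<in> \<T> \<and> rdim C \<C> n Y"
proof (induction n arbitrary: M)
  case 0
  then have "M \<in> \<T>" by simp
  then obtain f G g T where "ses C M f G g T" "G \<in> \<C>" "T \<in> \<T>"
    by (rule coproper_cogeneratorE[OF cog])
  then show ?case unfolding rdim.simps by blast
next
  case (Suc n)
  obtain L l X e where X: "X \<in> \<T>" and s: "ses C L l X e M" and L: "rdim C \<T> n L"
    using Suc.prems by auto
  obtain f Y g T where t: "ses C L f Y g T" and T: "T \<in> \<T>" and Y: "rdim C \<C> n Y"
    using Suc.IH[OF L] by blast
  obtain a P b a' b' where p: "ses C Y a P b M" and q: "ses C X a' P b' T"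
    using pushout_ses[OF s t] .
  have "P \<in> \<T>" by (rule resolving_extension[OF res q X T])
  then obtain u G v T' where c: "ses C P u G v T'" and G: "G \<in> \<C>" and T': "T' \<in> \<T>"
    by (rule coproper_cogeneratorE[OF cog])
  obtain h N r k where h: "ses C Y (u \<cdot> a) G h N" and r: "ses C M r N k T'"
    using mono_comp_ses[OF p c] .
  have "rdim C \<C> (Suc n) N" unfolding rdim.simps using G h Y by blast
  then show ?case using r T' by blast
qed

lemma mem_of_rdim_left_perp:
  assumes res: "resolving C \<T>" and enough: "enough_projectives C" and sub: "subcategory C \<C>"
    and CT: "\<C> \<subseteq> \<T>" and perp: "\<T> \<subseteq> left_perp C \<C>"
  shows "M \<in> \<T> \<Longrightarrow> rdim C \<C> m M \<Longrightarrow> M \<in> \<C>"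
proof (induction m arbitrary: M)
  case (Suc m)
  obtain K k G e where G: "G \<in> \<C>" and s: "ses C K k G e M" and K: "rdim C \<C> m K"
    using Suc.prems(2) by auto
  have "K \<in> \<T>" by (rule resolving_kernel[OF res s _ Suc.prems(1)]) (use G CT in blast)
  then have KC: "K \<in> \<C>" using Suc.IH K by blast
  have "trivial_group (Ext C 1 M K)" using perp Suc.prems(1) KC unfolding left_perp_def by blast
  then obtain \<sigma> where "\<sigma> \<in> Hom C M G" "e \<cdot> \<sigma> = idt C M"
    by (rule Ext1_trivial_splits[OF enough s])
  then have "is_biproduct C K M G" by (rule retraction_biproduct[OF s])
  then have "is_biproduct C M K G" unfolding is_biproduct_iff using biproduct_maps_swap by blast
  moreover have "\<forall>X\<in>Ob C. \<forall>Y\<in>Ob C. \<forall>S\<in>\<C>. is_biproduct C X Y S \<longrightarrow> X \<in> \<C>"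
    using sub unfolding subcategory_def by (elim conjE)
  ultimately show ?case using sesD(6,8)[OF s] G by blast
qed simp

lemma rdim_left_perp:
  assumes res: "resolving C \<T>" and enough: "enough_projectives C" and sub: "subcategory C \<C>"
    and CT: "\<C> \<subseteq> \<T>" and perp: "\<T> \<subseteq> left_perp C \<C>"
  shows "rdim C \<T> n M \<Longrightarrow> rdim C \<C> m M \<Longrightarrow> rdim C \<C> n M"
proof (induction n arbitrary: m M)
  case 0
  then show ?case using mem_of_rdim_left_perp[OF assms] by simp
next
  case (Suc n)
  show ?case
  proof (cases m)
    case 0
    then have "M \<in> \<C>" using Suc.prems(2) by simp
    then show ?thesis by (rule rdim_of_mem[OF sub])
  next
    case (Suc m')
    then obtain K k G e where G: "G \<in> \<C>" and s: "ses C K k G e M" and K: "rdim C \<C> m' K"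
      using Suc.prems(2) by auto
    have "rdim C \<T> n K"
      by (rule rdim_syzygy[OF res enough s _ Suc.prems(1)]) (use G CT in blast)
    then have "rdim C \<C> n K" using Suc.IH K by blast
    then show ?thesis unfolding rdim.simps using G s by blast
  qed
qed

end

theorem corollary3p5:
  fixes A :: "('o, 'm) cat" and \<E> \<T> \<C> :: "'o set"
  assumes "abelian_category A"
    and "enough_projectives A"
    and "subcategory A \<E>"
    and "resolving A \<T>"
    and "coproper_cogenerator A \<E> \<C> \<T>"
  shows "FPD A \<T> \<le> FPD A \<C> \<and>
    (\<T> \<subseteq> left_perp A \<C> \<longrightarrow>
       (\<forall>M\<in>Ob A. pd A \<C> M < \<infinity> \<longrightarrow> pd A \<T> M = pd A \<C> M)) \<and>
    (\<T> \<subseteq> left_perp A \<C> \<longrightarrow> FPD A \<T> = FPD A \<C>)"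
proof -
  interpret abelian_category A by fact
  have T: "subcategory A \<T>" using assms(4) by (simp add: resolving_def)
  have sub: "subcategory A \<C>" and CT: "\<C> \<subseteq> \<T>"
    using assms(5) by (simp_all add: coproper_cogenerator_def)
  note iff_T = has_resolution_iff_rdim[OF T] and iff_C = has_resolution_iff_rdim[OF sub]
  have FPD_ge: "pd A \<X> M \<le> FPD A \<X>" if "M \<in> Ob A" "pd A \<X> M < \<infinity>" for \<X> M
    unfolding FPD_def by (rule Sup_upper) (use that in blast)
  have part1: "FPD A \<T> \<le> FPD A \<C>"
    unfolding FPD_def[of A \<T>]
  proof (rule Sup_least, safe)
    fix M assume M: "M \<in> Ob A" and fin: "pd A \<T> M < \<infinity>"
    obtain n where n: "has_resolution A \<T> n M" using pd_attained[OF fin] .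
    then have "rdim A \<T> n M" by (simp add: iff_T)
    then obtain f Y g T' where s: "ses A M f Y g T'" and T': "T' \<in> \<T>" and Y: "rdim A \<C> n Y"
      using cogenerator_approximation[OF assms(4,5)] by blast
    have "pd A \<C> Y \<le> enat n" using pd_le iff_C Y by blast
    then have finY: "pd A \<C> Y < \<infinity>" using enat_ord_simps(4) le_less_trans by blast
    obtain m where m: "pd A \<C> Y = enat m" "has_resolution A \<C> m Y" using pd_attained[OF finY] .
    have "rdim A \<T> m Y" using m(2) rdim_mono_class[OF CT] by (simp add: iff_C)
    then have "has_resolution A \<T> m M" using rdim_kernel[OF assms(4) s T'] by (simp add: iff_T)
    then have "pd A \<T> M \<le> pd A \<C> Y" using pd_le m(1) by simp
    also have "\<dots> \<le> FPD A \<C>" by (rule FPD_ge[OF sesD(7)[OF s] finY])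
    finally show "pd A \<T> M \<le> FPD A \<C>" .
  qed
  have part2: "pd A \<T> M = pd A \<C> M"
    if perp: "\<T> \<subseteq> left_perp A \<C>" and fin: "pd A \<C> M < \<infinity>" for M
  proof (rule antisym)
    obtain m where m: "pd A \<C> M = enat m" "has_resolution A \<C> m M" using pd_attained[OF fin] .
    have mC: "rdim A \<C> m M" using m(2) by (simp add: iff_C)
    have "has_resolution A \<T> m M" using rdim_mono_class[OF CT mC] by (simp add: iff_T)
    then show le: "pd A \<T> M \<le> pd A \<C> M" using pd_le m(1) by simp
    obtain n where n: "pd A \<T> M = enat n" "has_resolution A \<T> n M"
      using pd_attained[OF le_less_trans[OF le fin]] .
    have "rdim A \<T> n M" using n(2) by (simp add: iff_T)
    then have "rdim A \<C> n M" by (rule rdim_left_perp[OF assms(4,2) sub CT perp _ mC])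
    then have "has_resolution A \<C> n M" by (simp add: iff_C)
    then show "pd A \<C> M \<le> pd A \<T> M" using pd_le n(1) by simp
  qed
  have part3: "FPD A \<C> \<le> FPD A \<T>" if perp: "\<T> \<subseteq> left_perp A \<C>"
    unfolding FPD_def[of A \<C>]
  proof (rule Sup_least, safe)
    fix M assume M: "M \<in> Ob A" and fin: "pd A \<C> M < \<infinity>"
    show "pd A \<C> M \<le> FPD A \<T>" using FPD_ge[OF M, of \<T>] part2[OF perp fin] fin by simp
  qed
  show ?thesis using part1 part2 antisym[OF part1 part3] by blast
qed

end
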